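(* Let $\mathcal U$ be a bipartite unitary channel with input systems $A$ (Alice), $B$ (Bob) and output systems $A'$ (Alice), $B'$ (Bob), all finite-dimensional, with $d_{A'}=d_B$ and $d_{B'}=d_A$. Then $\Sigma(\mathcal U)\le\Sigma(\mathcal S)$, where $\mathcal S$ is the SWAP channel between $A$ and $B$, regarded as a bipartite unitary channel with Alice's input $A$, Bob's input $B$, Alice's output $B$ and Bob's output $A$.
   Context: All systems are finite-dimensional quantum systems; system $X$ has complex Hilbert space $\mathcal H_X$ of dimension $d_X$, and the composite system $XY$ has Hilbert space $\mathcal H_X\otimes\mathcal H_Y$. $\mathsf{St}(X)$ is the set of density operators on $\mathcal H_X$. $\mathfrak C(X,Y)$ is the set of quantum channels (completely positive trace-preserving linear maps) from operators on $\mathcal H_X$ to operators on $\mathcal H_Y$. $\mathcal I_X$ is the identity channel on $X$. $\|X\|_1=\mathrm{Tr}\sqrt{X^\dagger X}$. For a Hermitian-preserving linear map $\mathcal L$ with input system $X$, the diamond norm is $\|\mathcal L\|_\diamond=\sup_{\rho\in\mathsf{St}(EX)}\|(\mathcal I_E\otimes\mathcal L)(\rho)\|_1$ with $E\cong X$. For a bipartite unitary channel $\mathcal U:\rho\mapsto U\rho U^\dagger$ with $U:\mathcal H_A\otimes\mathcal H_B\to\mathcal H_{A'}\otimes\mathcal H_{B'}$ unitary, the signalling of $\mathcal U$ (from $A$ to $B'$) is $$\Sigma(\mathcal U)=\inf_{\mathcal C\in\mathfrak C(B,B')}\|(\mathrm{Tr}_{A'}\otimes\mathcal I_{B'})\circ\mathcal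 U-\mathrm{Tr}_A\otimes\mathcal C\|_\diamond .$$ The SWAP gate is the unitary $S:\mathcal H_A\otimes\mathcal H_B\to\mathcal H_B\otimes\mathcal H_A$, $S(|\psi\rangle\otimes|\varphi\rangle)=|\varphi\rangle\otimes|\psi\rangle$, and $\mathcal S$ is the corresponding channel $\rho\mapsto S\rho S^\dagger$. *)

theory Defs
  imports "Jordan_Normal_Form.Schur_Decomposition"
begin

text \<open>
  A system \<open>X\<close> of dimension \<open>d\<close> has Hilbert space \<open>carrier_vec d\<close> (that is, $\mathbb{C}^d$), operators
  on it are elements of \<open>carrier_mat d d\<close>, and the composite of systems of dimensions \<open>m\<close> and \<open>n\<close>
  has dimension \<open>m * n\<close>, the basis vector $|i\rangle\otimes|k\rangle$ having index \<open>i * n + k\<close>.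
  The trivial system has dimension 1, and the encoding makes \<open>1 \<otimes> Y\<close> literally equal to \<open>Y\<close>.
\<close>

section \<open>Operators\<close>

definition kron_vec :: "complex vec \<Rightarrow> complex vec \<Rightarrow> complex vec" where
  "kron_vec v w = vec (dim_vec v * dim_vec w)
     (\<lambda>i. v $ (i div dim_vec w) * w $ (i mod dim_vec w))"

definition kron :: "complex mat \<Rightarrow> complex mat \<Rightarrow> complex mat" where
  "kron A B = mat (dim_row A * dim_row B) (dim_col A * dim_col B)
     (\<lambda>(i, j). A $$ (i div dim_row B, j div dim_col B) * B $$ (i mod dim_row B, j mod dim_col B))"

definition mat_trace :: "complex mat \<Rightarrow> complex" where
  "mat_trace A = (\<Sum>i<dim_row A. A $$ (i, i))"

text \<open>
  The order on \<^typ>\<open>complex\<close> is that of \<open>Complex_Order\<close>: \<open>0 \<le> z\<close> says that \<open>z\<close> is real and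
  nonnegative. Hence a positive operator in the sense below is automatically Hermitian.
\<close>
definition positive_op :: "nat \<Rightarrow> complex mat \<Rightarrow> bool" where
  "positive_op d A \<longleftrightarrow>
     A \<in> carrier_mat d d \<and> (\<forall>v \<in> carrier_vec d. 0 \<le> (A *\<^sub>v v) \<bullet>c v)"

definition states :: "nat \<Rightarrow> complex mat set" where
  "states d = {\<rho>. positive_op d \<rho> \<and> mat_trace \<rho> = 1}"

text \<open>The unique positive square root of a positive operator; only used for positive \<open>P\<close>.\<close>
definition op_sqrt :: "complex mat \<Rightarrow> complex mat" where
  "op_sqrt P = (THE R. positive_op (dim_row P) R \<and> R * R = P)"

definition trace_norm :: "complex mat \<Rightarrow> real" where
  "trace_norm A = Re (mat_trace (op_sqrt (mat_adjoint A * A)))"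

definition unitary_op :: "nat \<Rightarrow> nat \<Rightarrow> complex mat \<Rightarrow> bool" where
  "unitary_op d d' U \<longleftrightarrow> U \<in> carrier_mat d' d \<and>
     mat_adjoint U * U = 1\<^sub>m d \<and> U * mat_adjoint U = 1\<^sub>m d'"

section \<open>Linear maps between operator spaces and channels\<close>

text \<open>Maps are only ever considered on the operators of their input system; values elsewhere are irrelevant.\<close>
definition linear_map :: "nat \<Rightarrow> nat \<Rightarrow> (complex mat \<Rightarrow> complex mat) \<Rightarrow> bool" where
  "linear_map d d' L \<longleftrightarrow>
     (\<forall>A \<in> carrier_mat d d. L A \<in> carrier_mat d' d') \<and>
     (\<forall>A \<in> carrier_mat d d. \<forall>B \<in> carrier_mat d d. L (A + B) = L A + L B) \<and>
     (\<forall>c. \<forall>A \<in> carrier_mat d d. L (c \<cdot>\<^sub>m A) = c \<cdot>\<^sub>m L A)"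

definition mat_unit :: "nat \<Rightarrow> nat \<Rightarrow> nat \<Rightarrow> complex mat" where
  "mat_unit d i j = mat d d (\<lambda>(r, s). if r = i \<and> s = j then 1 else 0)"

text \<open>
  \<open>tensor_map dX dX' dY dY' L M\<close> is $L \otimes M$ for linear maps \<open>L\<close> from \<open>X\<close> to \<open>X'\<close> and \<open>M\<close> from
  \<open>Y\<close> to \<open>Y'\<close>: expand $\rho = \sum_{ijkl} \rho_{(i,k),(j,l)}\, |i\rangle\langle j| \otimes |k\rangle\langle l|$
  and apply $L \otimes M$ term by term. Lemma \<open>tensor_map_kron\<close> below is the defining property.
\<close>
definition tensor_map :: "nat \<Rightarrow> nat \<Rightarrow> nat \<Rightarrow> nat \<Rightarrow>
    (complex mat \<Rightarrow> complex mat) \<Rightarrow> (complex mat \<Rightarrow> complex mat) \<Rightarrow> complex mat \<Rightarrow> complex mat" where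
  "tensor_map dX dX' dY dY' L M \<rho> = mat (dX' * dY') (dX' * dY')
     (\<lambda>(r, s). \<Sum>i<dX. \<Sum>j<dX. \<Sum>k<dY. \<Sum>l<dY.
        \<rho> $$ (i * dY + k, j * dY + l) * kron (L (mat_unit dX i j)) (M (mat_unit dY k l)) $$ (r, s))"

definition completely_positive :: "nat \<Rightarrow> nat \<Rightarrow> (complex mat \<Rightarrow> complex mat) \<Rightarrow> bool" where
  "completely_positive d d' L \<longleftrightarrow>
     (\<forall>n P. positive_op (n * d) P \<longrightarrow> positive_op (n * d') (tensor_map n n d d' id L P))"

definition trace_preserving :: "nat \<Rightarrow> (complex mat \<Rightarrow> complex mat) \<Rightarrow> bool" where
  "trace_preserving d L \<longleftrightarrow> (\<forall>A \<in> carrier_mat d d. mat_trace (L A) = mat_trace A)"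

definition channels :: "nat \<Rightarrow> nat \<Rightarrow> (complex mat \<Rightarrow> complex mat) set" where
  "channels d d' = {C. linear_map d d' C \<and> completely_positive d d' C \<and> trace_preserving d C}"

text \<open>The trace as a map to the operators of the trivial system.\<close>
definition trace_map :: "complex mat \<Rightarrow> complex mat" where
  "trace_map A = mat 1 1 (\<lambda>_. mat_trace A)"

definition unitary_channel :: "complex mat \<Rightarrow> complex mat \<Rightarrow> complex mat" where
  "unitary_channel U \<rho> = U * \<rho> * mat_adjoint U"

text \<open>
  \<open>d\<close> and \<open>d'\<close> are the input and output dimensions of \<open>L\<close>; the reference system \<open>E\<close> also has
  dimension \<open>d\<close>.
\<close>
definition diamond_norm :: "nat \<Rightarrow> nat \<Rightarrow> (complex mat \<Rightarrow> complex mat) \<Rightarrow> real" where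
  "diamond_norm d d' L = (SUP \<rho> \<in> states (d * d). trace_norm (tensor_map d d d d' id L \<rho>))"

section \<open>Signalling and SWAP\<close>

definition signalling ::
    "nat \<Rightarrow> nat \<Rightarrow> nat \<Rightarrow> nat \<Rightarrow> (complex mat \<Rightarrow> complex mat) \<Rightarrow> real" where
  "signalling dA dB dA' dB' \<U> =
     (INF \<C> \<in> channels dB dB'.
        diamond_norm (dA * dB) dB'
          (\<lambda>\<rho>. tensor_map dA' 1 dB' dB' trace_map id (\<U> \<rho>) - tensor_map dA 1 dB dB' trace_map \<C> \<rho>))"

text \<open>
  Row \<open>b * dA + a\<close> is $|b\rangle\otimes|a\rangle$, column \<open>a * dB + b\<close> is $|a\rangle\otimes|b\rangle$;
  see lemma \<open>swap_op_kron_vec\<close>.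
\<close>
definition swap_op :: "nat \<Rightarrow> nat \<Rightarrow> complex mat" where
  "swap_op dA dB = mat (dB * dA) (dA * dB)
     (\<lambda>(r, c). if r div dA = c mod dB \<and> r mod dA = c div dB then 1 else 0)"

section \<open>Adequacy of the encodings\<close>

lemma pair_index_less:
  fixes i k m n :: nat
  assumes "i < m" "k < n"
  shows "i * n + k < m * n"
proof -
  have "i * n + k < Suc i * n" using assms by simp
  also have "\<dots> \<le> m * n" using assms by (intro mult_le_mono1) simp
  finally show ?thesis .
qed

lemma swap_op_kron_vec:
  assumes v: "v \<in> carrier_vec dA" and w: "w \<in> carrier_vec dB"
  shows "swap_op dA dB *\<^sub>v kron_vec v w = kron_vec w v"
proof (rule eq_vecI)
  show "dim_vec (swap_op dA dB *\<^sub>v kron_vec v w) = dim_vec (kron_vec w v)"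
    using v w by (simp add: swap_op_def kron_vec_def)
next
  fix r assume "r < dim_vec (kron_vec w v)"
  then have r: "r < dB * dA" using v w by (simp add: kron_vec_def)
  then have pos: "0 < dA" "0 < dB" by (auto intro: gr0I)
  let ?a = "r mod dA" and ?b = "r div dA"
  have a: "?a < dA" using pos by simp
  have b: "?b < dB" using r by (simp add: less_mult_imp_div_less)
  let ?c = "?a * dB + ?b"
  have c: "?c < dA * dB" using a b by (rule pair_index_less)
  have iff: "(?b = x mod dB \<and> ?a = x div dB) \<longleftrightarrow> x = ?c" for x
    using b by (metis div_mult_mod_eq div_mult_self3 mod_mult_self3 div_less mod_less
        add.right_neutral add_0 less_nat_zero_code)
  have "(swap_op dA dB *\<^sub>v kron_vec v w) $ r =
      (\<Sum>x\<in>{0..<dA * dB}. (if x = ?c then 1 else 0) * (v $ (x div dB) * w $ (x mod dB)))"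
    using r v w by (simp add: swap_op_def kron_vec_def scalar_prod_def iff cong: sum.cong_simp)
  also have "\<dots> = (\<Sum>x\<in>{0..<dA * dB}. if x = ?c then v $ (x div dB) * w $ (x mod dB) else 0)"
    by (rule sum.cong) auto
  also have "\<dots> = v $ ?a * w $ ?b" using b c by (simp add: sum.delta)
  also have "\<dots> = kron_vec w v $ r" using r v w by (simp add: kron_vec_def mult.commute)
  finally show "(swap_op dA dB *\<^sub>v kron_vec v w) $ r = kron_vec w v $ r" .
qed

lemma linear_map_entry:
  assumes L: "linear_map d d' L" and A: "A \<in> carrier_mat d d" and r: "r < d'" and s: "s < d'"
  shows "L A $$ (r, s) = (\<Sum>i<d. \<Sum>j<d. A $$ (i, j) * L (mat_unit d i j) $$ (r, s))"
proof -
  have carr: "L B \<in> carrier_mat d' d'" if "B \<in> carrier_mat d d" for B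
    using L that by (simp add: linear_map_def)
  have zero: "L (0\<^sub>m d d) $$ (r, s) = 0"
  proof -
    have z: "0\<^sub>m d d = (0::complex) \<cdot>\<^sub>m (0\<^sub>m d d)" by auto
    have "L (0\<^sub>m d d) = 0 \<cdot>\<^sub>m L (0\<^sub>m d d)"
      using L by (subst z) (simp add: linear_map_def del: smult_zero_mat)
    then have "L (0\<^sub>m d d) $$ (r, s) = (0 \<cdot>\<^sub>m L (0\<^sub>m d d)) $$ (r, s)" by simp
    then show ?thesis using carr[of "0\<^sub>m d d"] r s by simp
  qed
  define part where "part S = mat d d (\<lambda>p. if p \<in> S then A $$ p else 0)" for S
  have "L (part S) $$ (r, s) = (\<Sum>p\<in>S. A $$ p * L (mat_unit d (fst p) (snd p)) $$ (r, s))"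
    if "finite S" "S \<subseteq> {..<d} \<times> {..<d}" for S
    using that
  proof (induction S rule: finite_induct)
    case empty
    have "part {} = 0\<^sub>m d d" by (auto simp: part_def)
    then show ?case using zero by simp
  next
    case (insert p S)
    have eq: "part (insert p S) = part S + A $$ p \<cdot>\<^sub>m mat_unit d (fst p) (snd p)"
      using insert.hyps insert.prems by (intro eq_matI) (auto simp: part_def mat_unit_def)
    have c1: "part S \<in> carrier_mat d d" and c2: "mat_unit d (fst p) (snd p) \<in> carrier_mat d d"
      by (auto simp: part_def mat_unit_def)
    have "L (part (insert p S)) = L (part S) + A $$ p \<cdot>\<^sub>m L (mat_unit d (fst p) (snd p))"
      using L c1 c2 unfolding eq by (simp add: linear_map_def)
    then show ?case using insert carr[OF c1] carr[OF c2] r s by simp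
  qed
  from this[of "{..<d} \<times> {..<d}"]
  have "L (part ({..<d} \<times> {..<d})) $$ (r, s) =
      (\<Sum>p\<in>{..<d} \<times> {..<d}. A $$ p * L (mat_unit d (fst p) (snd p)) $$ (r, s))" by simp
  moreover have "part ({..<d} \<times> {..<d}) = A"
    using A by (intro eq_matI) (auto simp: part_def)
  ultimately show ?thesis by (simp add: sum.cartesian_product case_prod_beta)
qed

lemma tensor_map_kron:
  assumes L: "linear_map dX dX' L" and M: "linear_map dY dY' M"
    and A: "A \<in> carrier_mat dX dX" and B: "B \<in> carrier_mat dY dY"
  shows "tensor_map dX dX' dY dY' L M (kron A B) = kron (L A) (M B)"
proof (rule eq_matI)
  have LA: "L A' \<in> carrier_mat dX' dX'" if "A' \<in> carrier_mat dX dX" for A'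
    using L that by (simp add: linear_map_def)
  have MB: "M B' \<in> carrier_mat dY' dY'" if "B' \<in> carrier_mat dY dY" for B'
    using M that by (simp add: linear_map_def)
  have unit: "mat_unit d i j \<in> carrier_mat d d" for d i j by (simp add: mat_unit_def)
  show "dim_row (tensor_map dX dX' dY dY' L M (kron A B)) = dim_row (kron (L A) (M B))"
    "dim_col (tensor_map dX dX' dY dY' L M (kron A B)) = dim_col (kron (L A) (M B))"
    using LA[OF A] MB[OF B] by (auto simp: tensor_map_def kron_def)
  fix r s assume "r < dim_row (kron (L A) (M B))" "s < dim_col (kron (L A) (M B))"
  then have rs: "r < dX' * dY'" "s < dX' * dY'" using LA[OF A] MB[OF B] by (auto simp: kron_def)
  then have pos: "0 < dY'" by (auto intro: gr0I)
  let ?r1 = "r div dY'" and ?r2 = "r mod dY'" and ?s1 = "s div dY'" and ?s2 = "s mod dY'"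
  have b: "?r1 < dX'" "?s1 < dX'" "?r2 < dY'" "?s2 < dY'"
    using rs pos by (auto simp: less_mult_imp_div_less)
  have kAB: "kron A B $$ (i * dY + k, j * dY + l) = A $$ (i, j) * B $$ (k, l)"
    if "i < dX" "j < dX" "k < dY" "l < dY" for i j k l
    using that A B pair_index_less[of i dX k dY] pair_index_less[of j dX l dY]
    by (simp add: kron_def)
  have kLM: "kron (L A') (M B') $$ (r, s) = L A' $$ (?r1, ?s1) * M B' $$ (?r2, ?s2)"
    if "A' \<in> carrier_mat dX dX" "B' \<in> carrier_mat dY dY" for A' B'
    using rs LA[OF that(1)] MB[OF that(2)] by (simp add: kron_def)
  have "tensor_map dX dX' dY dY' L M (kron A B) $$ (r, s) =
      (\<Sum>i<dX. \<Sum>j<dX. \<Sum>k<dY. \<Sum>l<dY. (A $$ (i, j) * L (mat_unit dX i j) $$ (?r1, ?s1)) *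
         (B $$ (k, l) * M (mat_unit dY k l) $$ (?r2, ?s2)))"
    using rs unfolding tensor_map_def by (auto simp: kAB kLM unit intro!: sum.cong)
  also have "\<dots> = L A $$ (?r1, ?s1) * M B $$ (?r2, ?s2)"
    unfolding linear_map_entry[OF L A b(1,2)] linear_map_entry[OF M B b(3,4)]
    by (simp only: sum_distrib_right) (simp only: sum_distrib_left)
  also have "\<dots> = kron (L A) (M B) $$ (r, s)" by (rule kLM[OF A B, symmetric])
  finally show "tensor_map dX dX' dY dY' L M (kron A B) $$ (r, s) = kron (L A) (M B) $$ (r, s)" .
qed

end

theory Submission
  imports Defs "Jordan_Normal_Form.Spectral_Radius"
begin

text \<open>
  Both sides are compared with \<open>2 (1 - 1 / d\<^sub>A\<^sup>2)\<close>. For a unitary \<open>U\<close>, let Bob's channel feed the maximally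
  mixed state into Alice's input. The resulting map is $\mathrm{Tr}_{A'} \circ \mathcal{U}$ preceded by
  complete depolarisation of \<open>A\<close>, and depolarisation minus $d_A^{-2}\,\mathcal{I}$ is completely positive;
  so the difference of the two maps is a difference of completely positive maps, each scaling the trace by
  \<open>1 - 1 / d\<^sub>A\<^sup>2\<close>. For SWAP, send half of a maximally entangled state through \<open>A\<close>: the true output
  is that state, whereas $\mathrm{Tr}_A \otimes \mathcal{C}$ gives a product with a maximally mixed reference,
  whose overlap with it is \<open>1 / d\<^sub>A\<^sup>2\<close> for every \<open>\<C>\<close>.
\<close>

section \<open>Spectral theorem for Hermitian matrices\<close>

text \<open>The two bounds meet because \<open>1 / dA^2\<close> is the same quantity on both sides:
  the weight of the maximally entangled vector Phi in the maximally mixed state of two copies of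
  \<open>A\<close>. Up to normalisation that state is the Choi operator of complete depolarisation
  and |Phi><Phi| that of the identity, so 1/d^2 is the largest multiple of the identity map that can
  be split off. In the lower bound it reappears as <Phi| (1/d tensor sigma) |Phi> = Tr sigma / d^2,
  whatever the state sigma. The factor 2 comes from the two positive parts of a traceless Hermitian
  difference. Neither an optimal channel nor an optimal state has to be identified: one channel
  serves every input state, and one input state serves every channel. The shape of the proof is
  dictated by the definitions. \<open>op_sqrt\<close> is a definite description, so nothing can be
  said about \<open>trace_norm\<close> before the spectral theorem and uniqueness of positive roots
  are available; afterwards two inequalities, \<open>trace_norm_diff_le\<close> and
  \<open>trace_norm_ge\<close>, carry all the estimates. \<open>diamond_norm\<close> and
  \<open>signalling\<close> are a supremum and an infimum of reals, so boundedness and non-emptiness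
  must be settled as well.\<close>

lemma mat_adjoint_index [simp]:
  assumes "i < dim_col A" "j < dim_row A"
  shows "mat_adjoint A $$ (i, j) = conjugate (A $$ (j, i))"
  using assms by (simp add: mat_adjoint_def mat_of_rows_index)

lemma dim_mat_adjoint [simp]:
  "dim_row (mat_adjoint A) = dim_col A" "dim_col (mat_adjoint A) = dim_row A"
  by (simp_all add: mat_adjoint_def)

lemma mat_adjoint_carrier [simp]:
  "A \<in> carrier_mat m n \<Longrightarrow> mat_adjoint A \<in> carrier_mat n m"
  by (intro carrier_matI) auto

lemma mat_adjoint_adjoint [simp]:
  "mat_adjoint (mat_adjoint (A :: 'a :: conjugatable_field mat)) = A"
  by (intro eq_matI) auto

lemma mat_adjoint_mult:
  fixes A B :: "complex mat"
  assumes "A \<in> carrier_mat m n" "B \<in> carrier_mat n k"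
  shows "mat_adjoint (A * B) = mat_adjoint B * mat_adjoint A"
  using assms by (intro eq_matI) (auto simp: scalar_prod_def sum_conjugate mult.commute intro!: sum.cong)

lemma mult_mat_vec_index:
  assumes "A \<in> carrier_mat m n" "v \<in> carrier_vec n" "i < m"
  shows "(A *\<^sub>v v) $ i = (\<Sum>j<n. A $$ (i, j) * v $ j)"
  using assms by (auto simp: scalar_prod_def lessThan_atLeast0 intro!: sum.cong)

lemma cscalar_prod_sum:
  fixes v w :: "complex vec"
  assumes "w \<in> carrier_vec n"
  shows "v \<bullet>c w = (\<Sum>i<n. v $ i * cnj (w $ i))"
  using assms by (auto simp: scalar_prod_def lessThan_atLeast0 intro!: sum.cong)

lemma cscalar_prod_adjoint:
  fixes A :: "complex mat"
  assumes A: "A \<in> carrier_mat m n" and v: "v \<in> carrier_vec n" and w: "w \<in> carrier_vec m"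
  shows "(A *\<^sub>v v) \<bullet>c w = v \<bullet>c (mat_adjoint A *\<^sub>v w)"
proof -
  have "(A *\<^sub>v v) \<bullet>c w = (\<Sum>i<m. \<Sum>j<n. A $$ (i, j) * v $ j * cnj (w $ i))"
    using A v w by (simp add: cscalar_prod_sum mult_mat_vec_index sum_distrib_right del: index_mult_mat_vec)
  also have "\<dots> = (\<Sum>j<n. \<Sum>i<m. A $$ (i, j) * v $ j * cnj (w $ i))" by (rule sum.swap)
  also have "\<dots> = v \<bullet>c (mat_adjoint A *\<^sub>v w)"
    using A v w
    by (subst cscalar_prod_sum[OF mult_mat_vec_carrier[OF mat_adjoint_carrier[OF A] w]])
       (auto simp: mult_mat_vec_index[of _ n m] sum_distrib_left ac_simps
         simp del: index_mult_mat_vec intro!: sum.cong)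
  finally show ?thesis .
qed

lemma mult_mat_unit_vec:
  fixes A :: "'a :: comm_ring_1 mat"
  assumes A: "A \<in> carrier_mat m n" and j: "j < n"
  shows "A *\<^sub>v unit_vec n j = col A j"
  using assms by (intro eq_vecI) (auto simp: scalar_prod_right_unit)

lemma unitary_op_cscalar:
  assumes U: "unitary_op n m U" and v: "v \<in> carrier_vec n" and w: "w \<in> carrier_vec n"
  shows "(U *\<^sub>v v) \<bullet>c (U *\<^sub>v w) = v \<bullet>c w"
proof -
  have c: "U \<in> carrier_mat m n" and i: "mat_adjoint U * U = 1\<^sub>m n" using U by (auto simp: unitary_op_def)
  have "(U *\<^sub>v v) \<bullet>c (U *\<^sub>v w) = v \<bullet>c (mat_adjoint U *\<^sub>v (U *\<^sub>v w))"
    using c v w by (intro cscalar_prod_adjoint) auto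
  also have "mat_adjoint U *\<^sub>v (U *\<^sub>v w) = w"
    using c w i by (simp flip: assoc_mult_mat_vec[OF mat_adjoint_carrier[OF c] c w])
  finally show ?thesis .
qed

text \<open>A one-sided inverse of a square matrix is two-sided.\<close>

lemma unitary_opI:
  assumes U: "U \<in> carrier_mat n n" and i: "mat_adjoint U * U = 1\<^sub>m n"
  shows "unitary_op n n U"
  using U i mat_mult_left_right_inverse[OF mat_adjoint_carrier[OF U] U i]
  by (simp add: unitary_op_def)

lemma mat_of_orthonormal_unitary:
  fixes u :: "nat \<Rightarrow> complex vec"
  assumes c: "\<And>j. j < n \<Longrightarrow> u j \<in> carrier_vec n"
    and o: "\<And>i j. i < n \<Longrightarrow> j < n \<Longrightarrow> u i \<bullet>c u j = (if i = j then 1 else 0)"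
  shows "unitary_op n n (mat n n (\<lambda>(i, j). u j $ i))"
proof (rule unitary_opI)
  show "mat_adjoint (mat n n (\<lambda>(i, j). u j $ i)) * mat n n (\<lambda>(i, j). u j $ i) = 1\<^sub>m n"
  proof (rule eq_matI)
    fix i j assume "i < dim_row (1\<^sub>m n :: complex mat)" "j < dim_col (1\<^sub>m n :: complex mat)"
    then have ij: "i < n" "j < n" by auto
    have "(mat_adjoint (mat n n (\<lambda>(i, j). u j $ i)) * mat n n (\<lambda>(i, j). u j $ i)) $$ (i, j)
        = (\<Sum>k<n. u j $ k * cnj (u i $ k))"
      using ij by (auto simp: scalar_prod_def lessThan_atLeast0 mult.commute intro!: sum.cong)
    also have "\<dots> = u j \<bullet>c u i" using c[OF ij(1)] by (simp add: cscalar_prod_sum)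
    finally show "(mat_adjoint (mat n n (\<lambda>(i, j). u j $ i)) * mat n n (\<lambda>(i, j). u j $ i)) $$ (i, j)
        = 1\<^sub>m n $$ (i, j)" using ij o by auto
  qed auto
qed auto

lemma cscalar_prod_smult:
  fixes v w :: "complex vec"
  assumes "v \<in> carrier_vec n" "w \<in> carrier_vec n"
  shows "(a \<cdot>\<^sub>v v) \<bullet>c (b \<cdot>\<^sub>v w) = a * cnj b * (v \<bullet>c w)"
  using assms by (simp add: conjugate_smult_vec)

lemma cscalar_prod_normalised:
  fixes v :: "complex vec"
  assumes v: "v \<in> carrier_vec n" "v \<noteq> 0\<^sub>v n"
  obtains c where "c \<noteq> 0" "(c \<cdot>\<^sub>v v) \<bullet>c (c \<cdot>\<^sub>v v) = 1"
proof
  have p: "v \<bullet>c v > 0" using v by simp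
  define r where "r = Re (v \<bullet>c v)"
  have r: "v \<bullet>c v = of_real r" "r > 0"
    using p by (auto simp: r_def less_complex_def complex_eq_iff)
  show "complex_of_real (1 / sqrt r) \<noteq> 0" using r by simp
  show "(complex_of_real (1 / sqrt r) \<cdot>\<^sub>v v) \<bullet>c (complex_of_real (1 / sqrt r) \<cdot>\<^sub>v v) = 1"
    unfolding cscalar_prod_smult[OF v(1) v(1)] r(1) complex_cnj_complex_of_real of_real_mult[symmetric]
    using r(2) by simp
qed

text \<open>Basis completion followed by Gram-Schmidt keeps \<open>v\<close> as the first vector.
  The result is orthogonal but not normalised, so every vector is rescaled to become a column of
  \<open>W\<close>; this is the origin of the factor \<open>c\<close>.\<close>

lemma unitary_completion:
  fixes v :: "complex vec"
  assumes v: "v \<in> carrier_vec n" "v \<noteq> 0\<^sub>v n"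
  obtains W c where "unitary_op n n W" "c \<noteq> 0" "W *\<^sub>v unit_vec n 0 = c \<cdot>\<^sub>v v"
proof -
  interpret cof_vec_space n "TYPE(complex)" .
  have n: "n \<noteq> 0" using v by (metis carrier_vecD eq_vecI index_zero_vec(2) less_zeroE)
  define b where "b = basis_completion v"
  define ws where "ws = gram_schmidt n b"
  from basis_completion[OF v, folded b_def]
  have dist_b: "distinct b" and indep: "\<not> lin_dep (set b)" and b: "set b \<subseteq> carrier_vec n"
    and hdb: "hd b = v" and len_b: "length b = n" by auto
  from hdb len_b n obtain vs where bv: "b = v # vs" by (cases b) auto
  from gram_schmidt_result[OF b dist_b indep refl, folded ws_def]
  have ws: "set ws \<subseteq> carrier_vec n" "corthogonal ws" "length ws = n"
    by (auto simp: len_b)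
  from gram_schmidt_hd[OF v(1), of vs, folded bv] have hdws: "hd ws = v" unfolding ws_def .
  have wc: "ws ! j \<in> carrier_vec n" if "j < n" for j using ws that by auto
  have wn: "ws ! j \<noteq> 0\<^sub>v n" if "j < n" for j
    using corthogonalD[OF ws(2), of j j] that ws(3) wc[OF that] by auto
  have "\<forall>j. \<exists>c. j < n \<longrightarrow> c \<noteq> 0 \<and> (c \<cdot>\<^sub>v ws ! j) \<bullet>c (c \<cdot>\<^sub>v ws ! j) = 1"
    using cscalar_prod_normalised[OF wc wn] by metis
  then obtain c where c: "\<And>j. j < n \<Longrightarrow> c j \<noteq> 0 \<and> (c j \<cdot>\<^sub>v ws ! j) \<bullet>c (c j \<cdot>\<^sub>v ws ! j) = 1"
    by metis
  define u where "u j = c j \<cdot>\<^sub>v ws ! j" for j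
  define W where "W = mat n n (\<lambda>(i, j). u j $ i)"
  have uc: "u j \<in> carrier_vec n" if "j < n" for j using wc[OF that] by (simp add: u_def)
  have "u i \<bullet>c u j = (if i = j then 1 else 0)" if "i < n" "j < n" for i j
  proof (cases "i = j")
    case True
    then show ?thesis using c[OF that(1)] by (simp add: u_def)
  next
    case False
    then have "ws ! i \<bullet>c ws ! j = 0" using corthogonalD[OF ws(2), of i j] that ws(3) by simp
    then show ?thesis using False cscalar_prod_smult[OF wc[OF that(1)] wc[OF that(2)]] by (simp add: u_def)
  qed
  then have "unitary_op n n W" unfolding W_def using uc by (intro mat_of_orthonormal_unitary)
  moreover have "W *\<^sub>v unit_vec n 0 = c 0 \<cdot>\<^sub>v v"
  proof -
    have "W *\<^sub>v unit_vec n 0 = col W 0" using n by (intro mult_mat_unit_vec) (auto simp: W_def)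
    also have "\<dots> = u 0" using n uc[of 0] by (intro eq_vecI) (auto simp: W_def)
    also have "ws ! 0 = v" using hdws ws(3) n by (cases ws) auto
    then have "u 0 = c 0 \<cdot>\<^sub>v v" by (simp add: u_def)
    finally show ?thesis .
  qed
  moreover have "c 0 \<noteq> 0" using c[of 0] n by simp
  ultimately show thesis using that by blast
qed

text \<open>Deflation: a unitary \<open>W\<close> rotates some eigenvector onto the first basis
  vector. The first column of the rotated matrix \<open>B\<close> is then zero below the diagonal,
  Hermiticity clears the first row too and makes the eigenvalue real, and the induction hypothesis
  applies to the remaining block.\<close>

lemma hermitian_orthonormal_eigenvectors:
  fixes A :: "complex mat"
  assumes "A \<in> carrier_mat n n" "mat_adjoint A = A"
  shows "\<exists>(u :: nat \<Rightarrow> complex vec) (d :: nat \<Rightarrow> real). \<forall>i<n. u i \<in> carrier_vec n \<and>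
    A *\<^sub>v u i = complex_of_real (d i) \<cdot>\<^sub>v u i \<and> (\<forall>j<n. u i \<bullet>c u j = (if i = j then 1 else 0))"
  using assms
proof (induction n arbitrary: A)
  case 0
  then show ?case by simp
next
  case (Suc n)
  note A = Suc.prems(1) and herm = Suc.prems(2)
  obtain e where "eigenvalue A e"
    using spectrum_non_empty[OF A] by (auto simp: spectrum_def)
  then obtain v where v: "v \<in> carrier_vec (Suc n)" "v \<noteq> 0\<^sub>v (Suc n)" and ev: "A *\<^sub>v v = e \<cdot>\<^sub>v v"
    using A by (auto simp: eigenvalue_def eigenvector_def)
  obtain W c where W: "unitary_op (Suc n) (Suc n) W" and c: "c \<noteq> 0"
    and W0: "W *\<^sub>v unit_vec (Suc n) 0 = c \<cdot>\<^sub>v v"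
    using unitary_completion[OF v] .
  have Wc: "W \<in> carrier_mat (Suc n) (Suc n)" and WaW: "mat_adjoint W * W = 1\<^sub>m (Suc n)"
    and WWa: "W * mat_adjoint W = 1\<^sub>m (Suc n)"
    using W by (auto simp: unitary_op_def)
  note Wac = mat_adjoint_carrier[OF Wc]
  define B where "B = mat_adjoint W * (A * W)"
  have AWc: "A * W \<in> carrier_mat (Suc n) (Suc n)" using A Wc by simp
  have Bc: "B \<in> carrier_mat (Suc n) (Suc n)" using Wac AWc by (simp add: B_def)
  have WB: "W * B = A * W"
    unfolding B_def using assoc_mult_mat[OF Wc Wac AWc] WWa left_mult_one_mat[OF AWc] by simp
  have Bherm: "mat_adjoint B = B"
    unfolding B_def mat_adjoint_mult[OF Wac AWc] mat_adjoint_mult[OF A Wc] herm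
    using assoc_mult_mat[OF Wac A Wc] by simp
  have AWx: "A *\<^sub>v (W *\<^sub>v x) = W *\<^sub>v (B *\<^sub>v x)" if "x \<in> carrier_vec (Suc n)" for x
    using that WB by (simp flip: assoc_mult_mat_vec[OF A Wc] assoc_mult_mat_vec[OF Wc Bc])
  let ?e = "unit_vec (Suc n) 0 :: complex vec"
  have Be: "B *\<^sub>v ?e = e \<cdot>\<^sub>v ?e"
  proof -
    have "W *\<^sub>v (B *\<^sub>v ?e) = A *\<^sub>v (c \<cdot>\<^sub>v v)" using AWx[of ?e] W0 by simp
    also have "\<dots> = e \<cdot>\<^sub>v (c \<cdot>\<^sub>v v)"
      using A v ev by (simp add: mult_mat_vec smult_smult_assoc mult.commute)
    also have "\<dots> = W *\<^sub>v (e \<cdot>\<^sub>v ?e)" using Wc W0 by (simp add: mult_mat_vec)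
    finally have "mat_adjoint W *\<^sub>v (W *\<^sub>v (B *\<^sub>v ?e)) = mat_adjoint W *\<^sub>v (W *\<^sub>v (e \<cdot>\<^sub>v ?e))" by simp
    moreover have "mat_adjoint W *\<^sub>v (W *\<^sub>v x) = x" if "x \<in> carrier_vec (Suc n)" for x
      using WaW that by (simp flip: assoc_mult_mat_vec[OF Wac Wc])
    ultimately show ?thesis using Bc by simp
  qed
  have Bcol: "B $$ (i, 0) = (if i = 0 then e else 0)" if "i < Suc n" for i
  proof -
    have "B $$ (i, 0) = (B *\<^sub>v ?e) $ i"
      using Bc that by (subst mult_mat_unit_vec[OF Bc]) auto
    then show ?thesis using that unfolding Be by (auto simp: unit_vec_def)
  qed
  have Badj: "B $$ (i, j) = cnj (B $$ (j, i))" if "i < Suc n" "j < Suc n" for i j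
    using that Bc arg_cong[OF Bherm, of "\<lambda>M. M $$ (i, j)"] by simp
  have e_real: "e = complex_of_real (Re e)"
    using Badj[of 0 0] Bcol[of 0] by (simp add: complex_eq_iff)
  have Brow: "B $$ (0, i) = 0" if "i < Suc n" "i \<noteq> 0" for i
    using Badj[of 0 i] Bcol[of i] that by simp
  define B' where "B' = mat n n (\<lambda>(i, j). B $$ (Suc i, Suc j))"
  have B'c: "B' \<in> carrier_mat n n" by (simp add: B'_def)
  have "mat_adjoint B' = B'"
    by (rule eq_matI) (auto simp: B'_def intro: Badj[symmetric])
  from Suc.IH[OF B'c this] obtain u :: "nat \<Rightarrow> complex vec" and d :: "nat \<Rightarrow> real"
    where u: "\<And>i. i < n \<Longrightarrow> u i \<in> carrier_vec n"
      and eig: "\<And>i. i < n \<Longrightarrow> B' *\<^sub>v u i = complex_of_real (d i) \<cdot>\<^sub>v u i"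
      and orth: "\<And>i j. i < n \<Longrightarrow> j < n \<Longrightarrow> u i \<bullet>c u j = (if i = j then 1 else 0)"
    by blast
  \<comment> \<open>Eigenvectors of \<open>B\<close>: the first basis vector, and those of the block
    \<open>B'\<close> padded with a leading zero. Applying \<open>W\<close> turns them into
    eigenvectors of \<open>A\<close> without changing inner products.\<close>
  define x where "x i = (case i of 0 \<Rightarrow> ?e | Suc k \<Rightarrow> vCons 0 (u k))" for i
  define d' where "d' i = (case i of 0 \<Rightarrow> Re e | Suc k \<Rightarrow> d k)" for i
  have e_vCons: "?e = vCons 1 (0\<^sub>v n)"
    by (intro eq_vecI) (auto simp: unit_vec_def vec_index_vCons)
  have xc: "x i \<in> carrier_vec (Suc n)" if "i < Suc n" for i
    using that u by (auto simp: x_def split: nat.split)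
  have Bx: "B *\<^sub>v x i = complex_of_real (d' i) \<cdot>\<^sub>v x i" if "i < Suc n" for i
  proof (cases i)
    case 0
    then show ?thesis using Be e_real by (simp add: x_def d'_def)
  next
    case (Suc k)
    then have k: "k < n" using that by simp
    show ?thesis
    proof (rule eq_vecI)
      show "dim_vec (B *\<^sub>v x i) = dim_vec (complex_of_real (d' i) \<cdot>\<^sub>v x i)"
        using Bc xc[OF that] by simp
      fix r assume "r < dim_vec (complex_of_real (d' i) \<cdot>\<^sub>v x i)"
      then have r: "r < Suc n" using xc[OF that] by simp
      have "(B *\<^sub>v x i) $ r = (\<Sum>j<Suc n. B $$ (r, j) * x i $ j)"
        by (rule mult_mat_vec_index[OF Bc xc[OF that] r])
      also have "\<dots> = (\<Sum>j<n. B $$ (r, Suc j) * u k $ j)"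
        using u[OF k] unfolding sum.lessThan_Suc_shift by (simp add: x_def Suc)
      also have "\<dots> = (complex_of_real (d' i) \<cdot>\<^sub>v x i) $ r"
      proof (cases r)
        case 0
        then show ?thesis using Brow u[OF k] by (simp add: x_def Suc)
      next
        case (Suc q)
        then have q: "q < n" using r by simp
        have "(\<Sum>j<n. B $$ (r, Suc j) * u k $ j) = (B' *\<^sub>v u k) $ q"
          unfolding mult_mat_vec_index[OF B'c u[OF k] q] using Suc q by (simp add: B'_def)
        also have "\<dots> = complex_of_real (d k) * u k $ q" using eig[OF k] u[OF k] q by simp
        also have "\<dots> = (complex_of_real (d' i) \<cdot>\<^sub>v x i) $ r"
          using u[OF k] q by (simp add: x_def d'_def Suc \<open>i = Suc k\<close>)
        finally show ?thesis .
      qed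
      finally show "(B *\<^sub>v x i) $ r = (complex_of_real (d' i) \<cdot>\<^sub>v x i) $ r" .
    qed
  qed
  have xo: "x i \<bullet>c x j = (if i = j then 1 else 0)" if "i < Suc n" "j < Suc n" for i j
    using that u orth unfolding x_def e_vCons by (auto split: nat.split)
  show ?case
  proof (intro exI allI impI conjI)
    fix i assume i: "i < Suc n"
    show "W *\<^sub>v x i \<in> carrier_vec (Suc n)" using Wc xc[OF i] by simp
    show "A *\<^sub>v (W *\<^sub>v x i) = complex_of_real (d' i) \<cdot>\<^sub>v (W *\<^sub>v x i)"
      using AWx[OF xc[OF i]] Bx[OF i] Wc xc[OF i] by (simp add: mult_mat_vec)
    fix j assume j: "j < Suc n"
    show "(W *\<^sub>v x i) \<bullet>c (W *\<^sub>v x j) = (if i = j then 1 else 0)"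
      using unitary_op_cscalar[OF W xc[OF i] xc[OF j]] xo[OF i j] by simp
  qed
qed

section \<open>Positive operators and the trace norm\<close>

definition real_diag :: "nat \<Rightarrow> (nat \<Rightarrow> real) \<Rightarrow> complex mat" where
  "real_diag n d = mat n n (\<lambda>(i, j). if i = j then complex_of_real (d i) else 0)"

lemma real_diag_carrier [simp]: "real_diag n d \<in> carrier_mat n n"
  by (simp add: real_diag_def)

lemma dim_real_diag [simp]: "dim_row (real_diag n d) = n" "dim_col (real_diag n d) = n"
  by (simp_all add: real_diag_def)

lemma real_diag_adjoint [simp]: "mat_adjoint (real_diag n d) = real_diag n d"
  by (rule eq_matI) (auto simp: real_diag_def)

lemma real_diag_mult: "real_diag n d * real_diag n e = real_diag n (\<lambda>i. d i * e i)"
proof (rule eq_matI)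
  fix i j assume "i < dim_row (real_diag n (\<lambda>i. d i * e i))" "j < dim_col (real_diag n (\<lambda>i. d i * e i))"
  then have ij: "i < n" "j < n" by (auto simp: real_diag_def)
  have "(real_diag n d * real_diag n e) $$ (i, j) = (\<Sum>k<n. (if i = k then complex_of_real (d i) else 0) *
      (if k = j then complex_of_real (e k) else 0))"
    using ij by (auto simp: real_diag_def scalar_prod_def lessThan_atLeast0 intro!: sum.cong)
  also have "\<dots> = (\<Sum>k<n. if i = k then (if k = j then complex_of_real (d i) * complex_of_real (e k) else 0) else 0)"
    by (rule sum.cong) auto
  also have "\<dots> = real_diag n (\<lambda>i. d i * e i) $$ (i, j)"
    using ij by (simp add: real_diag_def)
  finally show "(real_diag n d * real_diag n e) $$ (i, j) = real_diag n (\<lambda>i. d i * e i) $$ (i, j)" .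
qed (auto simp: real_diag_def)

lemma mat_trace_comm:
  assumes "A \<in> carrier_mat m n" "B \<in> carrier_mat n m"
  shows "mat_trace (A * B) = mat_trace (B * A)"
proof -
  have "mat_trace (A * B) = (\<Sum>i<m. \<Sum>k<n. A $$ (i, k) * B $$ (k, i))"
    using assms by (auto simp: mat_trace_def scalar_prod_def lessThan_atLeast0 intro!: sum.cong)
  also have "\<dots> = (\<Sum>k<n. \<Sum>i<m. A $$ (i, k) * B $$ (k, i))" by (rule sum.swap)
  also have "\<dots> = mat_trace (B * A)"
    using assms by (auto simp: mat_trace_def scalar_prod_def lessThan_atLeast0 mult.commute intro!: sum.cong)
  finally show ?thesis .
qed

lemma unitary_op_adjoint:
  "unitary_op n m U \<Longrightarrow> unitary_op m n (mat_adjoint U)"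
  by (simp add: unitary_op_def)

lemma mat_trace_unitary_conj:
  assumes U: "unitary_op n m U" and X: "X \<in> carrier_mat n n"
  shows "mat_trace (U * X * mat_adjoint U) = mat_trace X"
proof -
  have c: "U \<in> carrier_mat m n" and i: "mat_adjoint U * U = 1\<^sub>m n" using U by (auto simp: unitary_op_def)
  have "mat_trace (U * X * mat_adjoint U) = mat_trace (mat_adjoint U * (U * X))"
    using c X by (intro mat_trace_comm[of _ m n]) auto
  also have "mat_adjoint U * (U * X) = X"
    using assoc_mult_mat[OF mat_adjoint_carrier[OF c] c X] i left_mult_one_mat[OF X] by simp
  finally show ?thesis .
qed

lemma unitary_conj_mult:
  assumes U: "unitary_op n m U" and X: "X \<in> carrier_mat n n" and Y: "Y \<in> carrier_mat n n"
  shows "(U * X * mat_adjoint U) * (U * Y * mat_adjoint U) = U * (X * Y) * mat_adjoint U"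
proof -
  have c: "U \<in> carrier_mat m n" and i: "mat_adjoint U * U = 1\<^sub>m n" using U by (auto simp: unitary_op_def)
  note ac = mat_adjoint_carrier[OF c]
  have UX: "U * X \<in> carrier_mat m n" and UY: "U * Y \<in> carrier_mat m n"
    and YU: "Y * mat_adjoint U \<in> carrier_mat n m" using c X Y ac by auto
  have "(U * X * mat_adjoint U) * (U * Y * mat_adjoint U)
      = U * X * (mat_adjoint U * (U * (Y * mat_adjoint U)))"
    using assoc_mult_mat[OF UX ac, of "U * (Y * mat_adjoint U)" m] c YU
    by (simp add: assoc_mult_mat[OF c Y ac])
  also have "mat_adjoint U * (U * (Y * mat_adjoint U)) = Y * mat_adjoint U"
    using assoc_mult_mat[OF ac c YU] i left_mult_one_mat[OF YU] by simp
  also have "U * X * (Y * mat_adjoint U) = U * (X * Y) * mat_adjoint U"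
    using assoc_mult_mat[OF UX Y ac] assoc_mult_mat[OF c X Y] by simp
  finally show ?thesis .
qed

lemma conj_adjoint:
  fixes U X :: "complex mat"
  assumes c: "U \<in> carrier_mat m n" and X: "X \<in> carrier_mat n n"
  shows "mat_adjoint (U * X * mat_adjoint U) = U * mat_adjoint X * mat_adjoint U"
proof -
  have UX: "U * X \<in> carrier_mat m n" using c X by simp
  show ?thesis
    unfolding mat_adjoint_mult[OF UX mat_adjoint_carrier[OF c]] mat_adjoint_mult[OF c X]
    using assoc_mult_mat[OF c mat_adjoint_carrier[OF X] mat_adjoint_carrier[OF c]] by simp
qed

lemma conj_form:
  fixes K P :: "complex mat"
  assumes K: "K \<in> carrier_mat m n" and P: "P \<in> carrier_mat n n" and v: "v \<in> carrier_vec m"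
    and w: "w \<in> carrier_vec m"
  shows "(K * P * mat_adjoint K *\<^sub>v v) \<bullet>c w = (P *\<^sub>v (mat_adjoint K *\<^sub>v v)) \<bullet>c (mat_adjoint K *\<^sub>v w)"
proof -
  note ac = mat_adjoint_carrier[OF K]
  have KP: "K * P \<in> carrier_mat m n" using K P by simp
  have av: "mat_adjoint K *\<^sub>v v \<in> carrier_vec n" using mult_mat_vec_carrier[OF ac v] .
  have "K * P * mat_adjoint K *\<^sub>v v = K *\<^sub>v (P *\<^sub>v (mat_adjoint K *\<^sub>v v))"
    using assoc_mult_mat_vec[OF KP ac v] assoc_mult_mat_vec[OF K P av] by simp
  then show ?thesis using cscalar_prod_adjoint[OF K mult_mat_vec_carrier[OF P av] w] by simp
qed

lemma positive_op_conj:
  assumes K: "K \<in> carrier_mat m n" and P: "positive_op n P"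
  shows "positive_op m (K * P * mat_adjoint K)"
proof -
  have Pc: "P \<in> carrier_mat n n" using P by (simp add: positive_op_def)
  have "0 \<le> (K * P * mat_adjoint K *\<^sub>v v) \<bullet>c v" if "v \<in> carrier_vec m" for v
    using P mult_mat_vec_carrier[OF mat_adjoint_carrier[OF K] that]
    unfolding conj_form[OF K Pc that that] positive_op_def by simp
  then show ?thesis using K Pc by (auto simp: positive_op_def)
qed

lemma unit_form:
  fixes A :: "complex mat"
  assumes "A \<in> carrier_mat n n" "i < n" "j < n"
  shows "(A *\<^sub>v unit_vec n j) \<bullet>c unit_vec n i = A $$ (i, j)"
proof -
  have u: "conjugate (unit_vec n i :: complex vec) = unit_vec n i"
    by (intro eq_vecI) (auto simp: unit_vec_def)
  show ?thesis using assms unfolding u by (simp add: mult_mat_unit_vec)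
qed

lemma positive_op_diag:
  assumes "positive_op n P" "i < n" shows "0 \<le> P $$ (i, i)"
  using assms unit_form[of P n i i] by (metis positive_op_def unit_vec_carrier)

text \<open>Polarisation: the form of \<open>P\<close> is real at every vector. At e_i + c e_j this
  forces c P_ij + cnj c P_ji to be real, the diagonal terms being real anyway; the choices c = 1 and
  c = i together give P_ji = cnj P_ij.\<close>

lemma positive_op_hermitian:
  assumes P: "positive_op n P"
  shows "mat_adjoint P = P"
proof -
  have Pc: "P \<in> carrier_mat n n" using P by (simp add: positive_op_def)
  have im: "Im ((P *\<^sub>v v) \<bullet>c v) = 0" if "v \<in> carrier_vec n" for v
    using P that by (auto simp: positive_op_def less_eq_complex_def)
  have ent: "P $$ (j, i) = cnj (P $$ (i, j))" if i: "i < n" and j: "j < n" for i j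
  proof -
    let ?i = "unit_vec n i :: complex vec" and ?j = "unit_vec n j :: complex vec"
    have "Im (c * P $$ (i, j) + cnj c * P $$ (j, i)) = 0" for c
    proof -
      let ?w = "?i + c \<cdot>\<^sub>v ?j"
      have Pi: "P *\<^sub>v ?i \<in> carrier_vec n" and Pj: "P *\<^sub>v ?j \<in> carrier_vec n"
        using Pc by auto
      have "P *\<^sub>v ?w = P *\<^sub>v ?i + c \<cdot>\<^sub>v (P *\<^sub>v ?j)"
        using Pc by (simp add: mult_add_distrib_mat_vec mult_mat_vec)
      moreover have "conjugate ?w = conjugate ?i + cnj c \<cdot>\<^sub>v conjugate ?j"
        using conjugate_add_vec[of ?i n "c \<cdot>\<^sub>v ?j"] by (simp add: conjugate_smult_vec)
      ultimately have "(P *\<^sub>v ?w) \<bullet>c ?w = P $$ (i, i) + cnj c * P $$ (j, i)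
          + c * P $$ (i, j) + c * cnj c * P $$ (j, j)"
        using Pi Pj unit_form[OF Pc i i] unit_form[OF Pc i j] unit_form[OF Pc j i] unit_form[OF Pc j j]
        by (simp add: add_scalar_prod_distrib[of _ n] scalar_prod_add_distrib[of _ n] algebra_simps
            del: scalar_prod_right_unit)
      moreover have "Im (P $$ (i, i)) = 0" "Im (P $$ (j, j)) = 0"
        using positive_op_diag[OF P] i j by (auto simp: less_eq_complex_def)
      ultimately show ?thesis using im[of ?w]
        by (simp add: complex_mult_cnj)
    qed
    from this[of 1] this[of \<i>] show ?thesis by (simp add: complex_eq_iff)
  qed
  show ?thesis using Pc by (intro eq_matI) (auto intro: ent[symmetric])
qed

lemma hermitian_spectral:
  assumes A: "A \<in> carrier_mat n n" and h: "mat_adjoint A = A"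
  obtains U d where "unitary_op n n U" "A = U * real_diag n d * mat_adjoint U"
proof -
  from hermitian_orthonormal_eigenvectors[OF A h] obtain u :: "nat \<Rightarrow> complex vec" and d :: "nat \<Rightarrow> real"
    where u: "\<And>i. i < n \<Longrightarrow> u i \<in> carrier_vec n"
      and eig: "\<And>i. i < n \<Longrightarrow> A *\<^sub>v u i = complex_of_real (d i) \<cdot>\<^sub>v u i"
      and orth: "\<And>i j. i < n \<Longrightarrow> j < n \<Longrightarrow> u i \<bullet>c u j = (if i = j then 1 else 0)"
    by blast
  define U where "U = mat n n (\<lambda>(i, j). u j $ i)"
  have U: "unitary_op n n U" unfolding U_def using u orth by (intro mat_of_orthonormal_unitary)
  then have Uc: "U \<in> carrier_mat n n" and inv: "U * mat_adjoint U = 1\<^sub>m n" by (auto simp: unitary_op_def)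
  have AU: "A * U = U * real_diag n d"
  proof (rule eq_matI)
    fix i j assume "i < dim_row (U * real_diag n d)" "j < dim_col (U * real_diag n d)"
    then have ij: "i < n" "j < n" using Uc real_diag_carrier[of n d] by auto
    have "col U j = u j" using ij u[OF ij(2)] by (intro eq_vecI) (auto simp: U_def)
    then have "(A * U) $$ (i, j) = (A *\<^sub>v u j) $ i" using A Uc ij by simp
    also have "\<dots> = complex_of_real (d j) * u j $ i" using eig[OF ij(2)] u[OF ij(2)] ij by simp
    also have "\<dots> = (\<Sum>k<n. u k $ i * (if k = j then complex_of_real (d k) else 0))"
      using ij by (subst sum.cong[OF refl, of _ _ "\<lambda>k. if k = j then complex_of_real (d k) * u k $ i else 0"]) auto
    also have "\<dots> = (U * real_diag n d) $$ (i, j)"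
      using ij by (auto simp: U_def real_diag_def scalar_prod_def lessThan_atLeast0 intro!: sum.cong)
    finally show "(A * U) $$ (i, j) = (U * real_diag n d) $$ (i, j)" .
  qed (use A Uc real_diag_carrier[of n d] in auto)
  have "U * real_diag n d * mat_adjoint U = A * (U * mat_adjoint U)"
    unfolding AU[symmetric] using A Uc by (intro assoc_mult_mat) auto
  then have "A = U * real_diag n d * mat_adjoint U" using inv right_mult_one_mat[OF A] by simp
  with U show thesis using that by blast
qed

lemma real_diag_form:
  assumes w: "w \<in> carrier_vec n"
  shows "(real_diag n d *\<^sub>v w) \<bullet>c w = complex_of_real (\<Sum>i<n. d i * (cmod (w $ i))\<^sup>2)"
proof -
  have "(real_diag n d *\<^sub>v w) $ i = complex_of_real (d i) * w $ i" if i: "i < n" for i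
  proof -
    have "(real_diag n d *\<^sub>v w) $ i = (\<Sum>j<n. if i = j then complex_of_real (d i) * w $ i else 0)"
      unfolding mult_mat_vec_index[OF real_diag_carrier w i]
      using i by (intro sum.cong) (auto simp: real_diag_def)
    also have "\<dots> = complex_of_real (d i) * w $ i" using i by simp
    finally show ?thesis .
  qed
  then have "(real_diag n d *\<^sub>v w) \<bullet>c w = (\<Sum>i<n. complex_of_real (d i) * (w $ i * cnj (w $ i)))"
    unfolding cscalar_prod_sum[OF w] by (auto simp: mult.assoc intro!: sum.cong simp del: index_mult_mat_vec)
  then show ?thesis by (simp add: complex_norm_square[symmetric] of_real_power)
qed

lemma positive_op_real_diag:
  assumes "\<And>i. i < n \<Longrightarrow> 0 \<le> d i" shows "positive_op n (real_diag n d)"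
  unfolding positive_op_def using assms
  by (auto simp: real_diag_form less_eq_complex_def intro!: sum_nonneg)

lemma unitary_conj_cancel:
  assumes U: "unitary_op n m U" and X: "X \<in> carrier_mat n n"
  shows "mat_adjoint U * (U * X * mat_adjoint U) * U = X"
proof -
  have c: "U \<in> carrier_mat m n" and i: "mat_adjoint U * U = 1\<^sub>m n" using U by (auto simp: unitary_op_def)
  note ac = mat_adjoint_carrier[OF c]
  have XU: "X * mat_adjoint U \<in> carrier_mat n m" using X ac by simp
  have "mat_adjoint U * (U * X * mat_adjoint U) = X * mat_adjoint U"
    unfolding assoc_mult_mat[OF c X ac] assoc_mult_mat[OF ac c XU, symmetric] i
    by (rule left_mult_one_mat[OF XU])
  then show ?thesis using assoc_mult_mat[OF X ac c] i right_mult_one_mat[OF X] by simp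
qed

text \<open>On an eigenvector of \<open>R - S\<close> the forms of \<open>R\<close> and \<open>S\<close> have equal squares: with \<open>D = R - S\<close>,
  \<open>D R + S D = R\<^sup>2 - S\<^sup>2 = 0\<close>.\<close>
lemma positive_sqrt_unique:
  assumes R: "positive_op n R" and S: "positive_op n S" and eq: "R * R = S * S"
  shows "R = S"
proof -
  have Rc: "R \<in> carrier_mat n n" and Sc: "S \<in> carrier_mat n n" using R S by (auto simp: positive_op_def)
  define D where "D = R - S"
  have Dc: "D \<in> carrier_mat n n" unfolding D_def by (rule minus_carrier_mat[OF Sc])
  have Dent: "D $$ (i, j) = R $$ (i, j) - S $$ (i, j)" if "i < n" "j < n" for i j
    using that Rc Sc by (simp add: D_def)
  have Dh: "mat_adjoint D = D"
  proof (rule eq_matI)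
    fix i j assume "i < dim_row D" "j < dim_col D"
    then have ij: "i < n" "j < n" using Dc by auto
    have "cnj (R $$ (j, i)) = R $$ (i, j)" "cnj (S $$ (j, i)) = S $$ (i, j)"
      using ij Rc Sc arg_cong[OF positive_op_hermitian[OF R], of "\<lambda>M. M $$ (i, j)"]
        arg_cong[OF positive_op_hermitian[OF S], of "\<lambda>M. M $$ (i, j)"] by auto
    then show "mat_adjoint D $$ (i, j) = D $$ (i, j)" using ij Dc by (simp add: Dent)
  qed (use Dc in auto)
  obtain U d where U: "unitary_op n n U" and DU: "D = U * real_diag n d * mat_adjoint U"
    using hermitian_spectral[OF Dc Dh] .
  have Uc: "U \<in> carrier_mat n n" using U by (simp add: unitary_op_def)
  note Ua = mat_adjoint_carrier[OF Uc]
  have UaU: "mat_adjoint U * U = 1\<^sub>m n" using U by (simp add: unitary_op_def)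
  define R' S' where "R' = mat_adjoint U * R * U" and "S' = mat_adjoint U * S * U"
  have R'c: "R' \<in> carrier_mat n n" and S'c: "S' \<in> carrier_mat n n"
    using Rc Sc Uc Ua by (auto simp: R'_def S'_def)
  have R': "positive_op n R'" and S': "positive_op n S'"
    using positive_op_conj[OF Ua R] positive_op_conj[OF Ua S] by (auto simp: R'_def S'_def)
  have R'S': "R' = real_diag n d + S'"
  proof -
    have "mat_adjoint U * D * U = real_diag n d"
      unfolding DU by (rule unitary_conj_cancel[OF U real_diag_carrier])
    moreover have "R = D + S" using Rc Sc by (intro eq_matI) (auto simp: D_def)
    then have "R' = mat_adjoint U * D * U + S'"
      unfolding R'_def S'_def using Dc Sc Uc Ua
      by (simp add: mult_add_distrib_mat[OF Ua Dc Sc]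
          add_mult_distrib_mat[OF mult_carrier_mat[OF Ua Dc] mult_carrier_mat[OF Ua Sc] Uc])
    ultimately show ?thesis by simp
  qed
  have sq: "R' * R' = S' * S'"
    using unitary_conj_mult[OF unitary_op_adjoint[OF U] Rc Rc]
      unitary_conj_mult[OF unitary_op_adjoint[OF U] Sc Sc] eq by (simp add: R'_def S'_def)
  have "d i = 0" if i: "i < n" for i
  proof -
    have ent: "R' $$ (k, l) = (if k = l then complex_of_real (d k) else 0) + S' $$ (k, l)"
      if "k < n" "l < n" for k l
      unfolding R'S' using that S'c by (simp add: real_diag_def)
    have m: "(X * X) $$ (i, i) = (\<Sum>k<n. X $$ (i, k) * X $$ (k, i))" if "X \<in> carrier_mat n n" for X :: "complex mat"
      using that i by (auto simp: scalar_prod_def lessThan_atLeast0 intro!: sum.cong)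
    \<comment> \<open>In the eigenbasis of \<open>D\<close> the matrices \<open>R'\<close> and
      \<open>S'\<close> differ only on the diagonal, so all terms with \<open>k\<close> different
      from \<open>i\<close> agree. The remaining one is a difference of squares, \<open>d i\<close>
      times the sum of the two diagonal entries. If \<open>d i\<close> were nonzero, that sum of
      nonnegative entries would vanish, hence both entries, hence their difference
      \<open>d i\<close>.\<close>
    have "(R' * R') $$ (i, i) = (\<Sum>k<n. S' $$ (i, k) * S' $$ (k, i) +
        (if k = i then complex_of_real (d i) * (R' $$ (i, i) + S' $$ (i, i)) else 0))"
      unfolding m[OF R'c] using i by (intro sum.cong) (auto simp: ent algebra_simps)
    also have "\<dots> = (S' * S') $$ (i, i) + complex_of_real (d i) * (R' $$ (i, i) + S' $$ (i, i))"
      unfolding m[OF S'c] using i by (simp add: sum.distrib)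
    finally have z: "complex_of_real (d i) * (R' $$ (i, i) + S' $$ (i, i)) = 0" using sq by simp
    show ?thesis
    proof (rule ccontr)
      assume nz: "d i \<noteq> 0"
      then have "R' $$ (i, i) + S' $$ (i, i) = 0" using z by simp
      then have "R' $$ (i, i) = 0" "S' $$ (i, i) = 0"
        using positive_op_diag[OF R' i] positive_op_diag[OF S' i] by (auto simp: add_nonneg_eq_0_iff)
      then show False using ent[OF i i] nz by simp
    qed
  qed
  then have "real_diag n d = 0\<^sub>m n n" by (intro eq_matI) (auto simp: real_diag_def)
  then have "D = 0\<^sub>m n n" using DU Uc Ua by simp
  then show ?thesis using Rc Sc Dent by (intro eq_matI) auto
qed

text \<open>Taking absolute values of the eigenvalues gives a positive root of the square, and
  uniqueness of positive roots identifies it with the description in \<open>op_sqrt\<close>.\<close>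

lemma trace_norm_spectral:
  assumes U: "unitary_op n n U"
  shows "trace_norm (U * real_diag n d * mat_adjoint U) = (\<Sum>i<n. \<bar>d i\<bar>)"
proof -
  have Uc: "U \<in> carrier_mat n n" using U by (simp add: unitary_op_def)
  note Ua = mat_adjoint_carrier[OF Uc]
  define R where "R = U * real_diag n (\<lambda>i. \<bar>d i\<bar>) * mat_adjoint U"
  define A where "A = U * real_diag n d * mat_adjoint U"
  have Ac: "A \<in> carrier_mat n n" using Uc Ua by (auto simp: A_def)
  have R: "positive_op n R" unfolding R_def by (intro positive_op_conj[OF Uc] positive_op_real_diag) auto
  have RR: "R * R = mat_adjoint A * A"
    unfolding R_def A_def conj_adjoint[OF Uc real_diag_carrier]
    by (simp add: unitary_conj_mult[OF U] real_diag_mult)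
  have "op_sqrt (mat_adjoint A * A) = R"
    unfolding op_sqrt_def
  proof (rule the_equality)
    show "positive_op (dim_row (mat_adjoint A * A)) R \<and> R * R = mat_adjoint A * A" using R RR Ac by simp
    fix S assume "positive_op (dim_row (mat_adjoint A * A)) S \<and> S * S = mat_adjoint A * A"
    then show "S = R" using positive_sqrt_unique[of n S R] R RR Ac by simp
  qed
  then have "trace_norm A = Re (mat_trace (real_diag n (\<lambda>i. \<bar>d i\<bar>)))"
    by (simp add: trace_norm_def R_def mat_trace_unitary_conj[OF U])
  then show ?thesis by (simp add: A_def mat_trace_def real_diag_def)
qed

lemma mat_trace_diff:
  assumes "A \<in> carrier_mat n n" "B \<in> carrier_mat n n"
  shows "mat_trace (A - B) = mat_trace A - mat_trace B"
  using assms by (simp add: mat_trace_def sum_subtractf)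

lemma diff_hermitian:
  fixes X Y :: "complex mat"
  assumes "X \<in> carrier_mat n n" "Y \<in> carrier_mat n n" "mat_adjoint X = X" "mat_adjoint Y = Y"
  shows "mat_adjoint (X - Y) = X - Y"
proof (rule eq_matI)
  fix i j assume "i < dim_row (X - Y)" "j < dim_col (X - Y)"
  then have ij: "i < n" "j < n" using assms by auto
  have "cnj (X $$ (j, i)) = X $$ (i, j)" "cnj (Y $$ (j, i)) = Y $$ (i, j)"
    using ij assms(1,2) arg_cong[OF assms(3), of "\<lambda>M. M $$ (i, j)"]
      arg_cong[OF assms(4), of "\<lambda>M. M $$ (i, j)"] by auto
  then show "mat_adjoint (X - Y) $$ (i, j) = (X - Y) $$ (i, j)" using ij assms(1,2) by simp
qed (use assms in auto)

lemma trace_norm_nonneg: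
  assumes "A \<in> carrier_mat n n" "mat_adjoint A = A"
  shows "0 \<le> trace_norm A"
proof -
  obtain U d where U: "unitary_op n n U" and A: "A = U * real_diag n d * mat_adjoint U"
    using hermitian_spectral[OF assms] .
  show ?thesis unfolding A trace_norm_spectral[OF U] by (simp add: sum_nonneg)
qed

text \<open>In an eigenbasis of \<open>X - Y\<close> each eigenvalue is the difference of two
  diagonal entries, both nonnegative, so its absolute value is at most their sum. This is the one
  instance of the triangle inequality that the upper bounds rely on.\<close>

lemma trace_norm_diff_le:
  assumes X: "positive_op n X" and Y: "positive_op n Y"
  shows "trace_norm (X - Y) \<le> Re (mat_trace X) + Re (mat_trace Y)"
proof -
  have Xc: "X \<in> carrier_mat n n" and Yc: "Y \<in> carrier_mat n n" using X Y by (auto simp: positive_op_def)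
  have Dc: "X - Y \<in> carrier_mat n n" by (rule minus_carrier_mat[OF Yc])
  obtain U d where U: "unitary_op n n U" and D: "X - Y = U * real_diag n d * mat_adjoint U"
    using hermitian_spectral[OF Dc diff_hermitian[OF Xc Yc positive_op_hermitian[OF X] positive_op_hermitian[OF Y]]] .
  have Uc: "U \<in> carrier_mat n n" using U by (simp add: unitary_op_def)
  note Ua = mat_adjoint_carrier[OF Uc]
  define X' Y' where "X' = mat_adjoint U * X * U" and "Y' = mat_adjoint U * Y * U"
  have X': "positive_op n X'" and Y': "positive_op n Y'"
    using positive_op_conj[OF Ua X] positive_op_conj[OF Ua Y] by (auto simp: X'_def Y'_def)
  have c: "X' \<in> carrier_mat n n" "Y' \<in> carrier_mat n n" using X' Y' by (auto simp: positive_op_def)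
  have tr: "mat_trace X' = mat_trace X" "mat_trace Y' = mat_trace Y"
    using mat_trace_unitary_conj[OF unitary_op_adjoint[OF U] Xc]
      mat_trace_unitary_conj[OF unitary_op_adjoint[OF U] Yc] by (auto simp: X'_def Y'_def)
  have "X' - Y' = mat_adjoint U * (X - Y) * U"
    unfolding X'_def Y'_def using Xc Yc Uc Ua
    by (simp add: mult_minus_distrib_mat[OF Ua Xc Yc]
          minus_mult_distrib_mat[OF mult_carrier_mat[OF Ua Xc] mult_carrier_mat[OF Ua Yc] Uc])
  also have "\<dots> = real_diag n d" unfolding D by (rule unitary_conj_cancel[OF U real_diag_carrier])
  finally have e: "X' - Y' = real_diag n d" .
  have "\<bar>d i\<bar> \<le> Re (X' $$ (i, i)) + Re (Y' $$ (i, i))" if i: "i < n" for i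
  proof -
    have "complex_of_real (d i) = X' $$ (i, i) - Y' $$ (i, i)"
      using arg_cong[OF e, of "\<lambda>M. M $$ (i, i)"] i c by (simp add: real_diag_def)
    then have "d i = Re (X' $$ (i, i)) - Re (Y' $$ (i, i))" by (simp add: complex_eq_iff)
    then show ?thesis
      using positive_op_diag[OF X' i] positive_op_diag[OF Y' i] by (auto simp: less_eq_complex_def)
  qed
  then have "(\<Sum>i<n. \<bar>d i\<bar>) \<le> (\<Sum>i<n. Re (X' $$ (i, i)) + Re (Y' $$ (i, i)))"
    by (intro sum_mono) auto
  also have "\<dots> = Re (mat_trace X') + Re (mat_trace Y')"
    using c by (simp add: mat_trace_def sum.distrib)
  finally have "(\<Sum>i<n. \<bar>d i\<bar>) \<le> Re (mat_trace X') + Re (mat_trace Y')" .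
  then show ?thesis unfolding D trace_norm_spectral[OF U] tr .
qed

text \<open>This is \<open>\<parallel>H\<parallel>\<^sub>1 \<ge> Tr (W H)\<close> for the reflection \<open>W = 2 |v\<rangle>\<langle>v| - 1\<close>.\<close>
lemma trace_norm_ge:
  assumes H: "H \<in> carrier_mat n n" "mat_adjoint H = H" and v: "v \<in> carrier_vec n" "v \<bullet>c v = 1"
  shows "2 * Re ((H *\<^sub>v v) \<bullet>c v) - Re (mat_trace H) \<le> trace_norm H"
proof -
  obtain U d where U: "unitary_op n n U" and D: "H = U * real_diag n d * mat_adjoint U"
    using hermitian_spectral[OF H] .
  have Uc: "U \<in> carrier_mat n n" using U by (simp add: unitary_op_def)
  define w where "w = mat_adjoint U *\<^sub>v v"
  have w: "w \<in> carrier_vec n" using mult_mat_vec_carrier[OF mat_adjoint_carrier[OF Uc] v(1)] by (simp add: w_def)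
  have "w \<bullet>c w = 1"
    unfolding w_def using unitary_op_cscalar[OF unitary_op_adjoint[OF U] v(1) v(1)] v(2) by simp
  then have "complex_of_real (\<Sum>i<n. (cmod (w $ i))\<^sup>2) = 1"
    unfolding cscalar_prod_sum[OF w] by (simp add: complex_norm_square[symmetric] of_real_power)
  then have s: "(\<Sum>i<n. (cmod (w $ i))\<^sup>2) = 1" using of_real_eq_1_iff by blast
  have le1: "(cmod (w $ i))\<^sup>2 \<le> 1" if "i < n" for i
    using that member_le_sum[of i "{..<n}" "\<lambda>i. (cmod (w $ i))\<^sup>2"] s by auto
  have "(H *\<^sub>v v) \<bullet>c v = complex_of_real (\<Sum>i<n. d i * (cmod (w $ i))\<^sup>2)"
    unfolding D conj_form[OF Uc real_diag_carrier v(1) v(1)] w_def[symmetric] by (rule real_diag_form[OF w])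
  moreover have "mat_trace H = complex_of_real (\<Sum>i<n. d i)"
    unfolding D mat_trace_unitary_conj[OF U real_diag_carrier] by (simp add: mat_trace_def real_diag_def)
  ultimately have "2 * Re ((H *\<^sub>v v) \<bullet>c v) - Re (mat_trace H) = (\<Sum>i<n. d i * (2 * (cmod (w $ i))\<^sup>2 - 1))"
    by (simp add: sum_subtractf sum_distrib_left algebra_simps)
  \<comment> \<open>The numbers 2 |w_i|^2 - 1 are the diagonal entries of the reflection in the
    eigenbasis of \<open>H\<close>; as \<open>w\<close> is a unit vector, they lie between -1 and
    1.\<close>
  also have "\<dots> \<le> (\<Sum>i<n. \<bar>d i\<bar>)"
  proof (rule sum_mono)
    fix i assume "i \<in> {..<n}"
    then have "\<bar>2 * (cmod (w $ i))\<^sup>2 - 1\<bar> \<le> 1" using le1[of i] by (auto simp: abs_le_iff)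
    then have "\<bar>d i * (2 * (cmod (w $ i))\<^sup>2 - 1)\<bar> \<le> \<bar>d i\<bar>" by (simp add: abs_mult mult_left_le)
    then show "d i * (2 * (cmod (w $ i))\<^sup>2 - 1) \<le> \<bar>d i\<bar>" by linarith
  qed
  also have "\<dots> = trace_norm H" unfolding D by (rule trace_norm_spectral[OF U, symmetric])
  finally show ?thesis .
qed

section \<open>Maps tensored with the identity\<close>

lemma pair_div [simp]: "k < d \<Longrightarrow> (i * d + k) div d = (i :: nat)"
  and pair_mod [simp]: "k < d \<Longrightarrow> (i * d + k) mod d = (k :: nat)"
  by simp_all

lemma pair_index_eq [simp]:
  "k < d \<Longrightarrow> l < d \<Longrightarrow> i * d + k = j * d + l \<longleftrightarrow> i = j \<and> k = (l :: nat)"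
  by (metis pair_div pair_mod)

lemma pair_indexE:
  assumes "x < m * (n :: nat)"
  obtains i k where "i < m" "k < n" "x = i * n + k"
proof
  have n: "0 < n" using assms by (auto intro: gr0I)
  show "x div n < m" using assms by (simp add: less_mult_imp_div_less)
  show "x mod n < n" using n by simp
  show "x = x div n * n + x mod n" by simp
qed

lemma sum_pair_index:
  fixes f :: "nat \<Rightarrow> 'a :: comm_monoid_add"
  shows "(\<Sum>x<m * n. f x) = (\<Sum>i<m. \<Sum>k<n. f (i * n + k))"
proof (induction m)
  case (Suc m)
  have "(\<Sum>x<Suc m * n. f x) = (\<Sum>x<m * n. f x) + (\<Sum>x\<in>{m * n..<m * n + n}. f x)"
    using sum.atLeastLessThan_concat[of 0 "m * n" "m * n + n" f]
    by (simp add: lessThan_atLeast0 add.commute)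
  also have "(\<Sum>x\<in>{m * n..<m * n + n}. f x) = (\<Sum>k<n. f (m * n + k))"
    using sum.shift_bounds_nat_ivl[of f 0 "m * n" n] by (simp add: lessThan_atLeast0 add.commute)
  finally show ?case using Suc by simp
qed simp

lemma eq_mat_pairI:
  assumes "A \<in> carrier_mat (m * n) (m * n)" "B \<in> carrier_mat (m * n) (m * n)"
    and "\<And>i j k l. i < m \<Longrightarrow> j < m \<Longrightarrow> k < n \<Longrightarrow> l < n \<Longrightarrow>
      A $$ (i * n + k, j * n + l) = B $$ (i * n + k, j * n + l)"
  shows "A = B"
proof (rule eq_matI)
  fix x y assume "x < dim_row B" "y < dim_col B"
  then have "x < m * n" "y < m * n" using assms(2) by auto
  then show "A $$ (x, y) = B $$ (x, y)" by (elim pair_indexE) (simp add: assms(3))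
qed (use assms in auto)

lemma mat_trace_pair:
  assumes "A \<in> carrier_mat (m * n) (m * n)"
  shows "mat_trace A = (\<Sum>i<m. \<Sum>k<n. A $$ (i * n + k, i * n + k))"
  using assms by (simp add: mat_trace_def sum_pair_index)

text \<open>The partial matrix element <i| rho |j> over the first factor: rho is read as a matrix
  whose entries are operators on the second factor, of dimension \<open>d\<close>.\<close>

definition block :: "nat \<Rightarrow> nat \<Rightarrow> nat \<Rightarrow> complex mat \<Rightarrow> complex mat" where
  "block d i j \<rho> = mat d d (\<lambda>(k, l). \<rho> $$ (i * d + k, j * d + l))"

lemma block_carrier [simp]: "block d i j \<rho> \<in> carrier_mat d d"
  by (simp add: block_def)

lemma mat_unit_carrier [simp]: "mat_unit d i j \<in> carrier_mat d d"
  by (simp add: mat_unit_def)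

lemma linear_mapD:
  assumes "linear_map d d' L"
  shows "A \<in> carrier_mat d d \<Longrightarrow> L A \<in> carrier_mat d' d'"
    and "A \<in> carrier_mat d d \<Longrightarrow> B \<in> carrier_mat d d \<Longrightarrow> L (A + B) = L A + L B"
    and "A \<in> carrier_mat d d \<Longrightarrow> L (c \<cdot>\<^sub>m A) = c \<cdot>\<^sub>m L A"
  using assms by (auto simp: linear_map_def)

lemma tensor_map_carrier [simp]:
  "tensor_map dX dX' dY dY' L M \<rho> \<in> carrier_mat (dX' * dY') (dX' * dY')"
  by (simp add: tensor_map_def)

lemma dim_tensor_map [simp]:
  "dim_row (tensor_map dX dX' dY dY' L M \<rho>) = dX' * dY'"
  "dim_col (tensor_map dX dX' dY dY' L M \<rho>) = dX' * dY'"
  by (simp_all add: tensor_map_def)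

lemma kron_carrier:
  "A \<in> carrier_mat m n \<Longrightarrow> B \<in> carrier_mat p q \<Longrightarrow> kron A B \<in> carrier_mat (m * p) (n * q)"
  by (auto simp: kron_def)

lemma kron_entry:
  assumes "A \<in> carrier_mat m n" "B \<in> carrier_mat p q" "a < m" "b < n" "r < p" "s < q"
  shows "kron A B $$ (a * p + r, b * q + s) = A $$ (a, b) * B $$ (r, s)"
  using assms pair_index_less[of a m r p] pair_index_less[of b n s q] by (simp add: kron_def)

lemma sum4_delta:
  fixes f :: "nat \<Rightarrow> nat \<Rightarrow> nat \<Rightarrow> nat \<Rightarrow> 'a :: comm_monoid_add"
  assumes "i < n" "j < n"
  shows "(\<Sum>i'<n. \<Sum>j'<n. \<Sum>k\<in>S. \<Sum>l\<in>T. if i = i' \<and> j = j' then f i' j' k l else 0)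
    = (\<Sum>k\<in>S. \<Sum>l\<in>T. f i j k l)"
proof -
  have "(\<Sum>i'<n. \<Sum>j'<n. \<Sum>k\<in>S. \<Sum>l\<in>T. if i = i' \<and> j = j' then f i' j' k l else 0)
      = (\<Sum>i'<n. if i = i' then (\<Sum>j'<n. if j = j' then (\<Sum>k\<in>S. \<Sum>l\<in>T. f i' j' k l) else 0) else 0)"
  proof (intro sum.cong refl)
    fix i'
    have "(\<Sum>k\<in>S. \<Sum>l\<in>T. if i = i' \<and> j = j' then f i' j' k l else 0)
        = (if i = i' \<and> j = j' then (\<Sum>k\<in>S. \<Sum>l\<in>T. f i' j' k l) else 0)" for j'
      by (cases "i = i'"; cases "j = j'") simp_all
    then show "(\<Sum>j'<n. \<Sum>k\<in>S. \<Sum>l\<in>T. if i = i' \<and> j = j' then f i' j' k l else 0)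
        = (if i = i' then (\<Sum>j'<n. if j = j' then (\<Sum>k\<in>S. \<Sum>l\<in>T. f i' j' k l) else 0) else 0)" by simp
  qed
  then show ?thesis using assms by (simp only: sum.delta' finite_lessThan lessThan_iff if_True)
qed

text \<open>Matrix units in the first factor fix the outer indices, and linearity of
  \<open>L\<close> reassembles the inner sums: tensoring with the identity means applying
  \<open>L\<close> to each block separately. Differences, multiples, compositions and traces of such
  maps are all reduced to this.\<close>

lemma tensor_id_entry:
  assumes L: "linear_map d d' L" and ij: "i < n" "j < n" and rs: "r < d'" "s < d'"
  shows "tensor_map n n d d' id L \<rho> $$ (i * d' + r, j * d' + s) = L (block d i j \<rho>) $$ (r, s)"
proof -
  have kr: "kron (mat_unit n i' j') (L (mat_unit d k l)) $$ (i * d' + r, j * d' + s)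
      = (if i = i' \<and> j = j' then L (mat_unit d k l) $$ (r, s) else 0)" for i' j' k l
    unfolding kron_entry[OF mat_unit_carrier linear_mapD(1)[OF L mat_unit_carrier] ij rs]
    using ij by (auto simp: mat_unit_def)
  have "tensor_map n n d d' id L \<rho> $$ (i * d' + r, j * d' + s) =
     (\<Sum>i'<n. \<Sum>j'<n. \<Sum>k<d. \<Sum>l<d. if i = i' \<and> j = j' then
        \<rho> $$ (i' * d + k, j' * d + l) * L (mat_unit d k l) $$ (r, s) else 0)"
    using pair_index_less[OF ij(1) rs(1)] pair_index_less[OF ij(2) rs(2)]
    by (simp add: tensor_map_def kr if_distrib cong: if_cong)
  also have "\<dots> = (\<Sum>k<d. \<Sum>l<d. \<rho> $$ (i * d + k, j * d + l) * L (mat_unit d k l) $$ (r, s))"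
    by (rule sum4_delta[OF ij])
  also have "\<dots> = L (block d i j \<rho>) $$ (r, s)"
    unfolding linear_map_entry[OF L block_carrier rs] by (simp add: block_def)
  finally show ?thesis .
qed

lemma block_tensor_id:
  assumes L: "linear_map d d' L" and ij: "i < n" "j < n"
  shows "block d' i j (tensor_map n n d d' id L \<rho>) = L (block d i j \<rho>)"
  using linear_mapD(1)[OF L block_carrier[of d i j \<rho>]]
  by (intro eq_matI) (auto simp: block_def[of d'] tensor_id_entry[OF L ij])

lemma linear_map_comp:
  assumes "linear_map d d' L" "linear_map d' d'' M"
  shows "linear_map d d'' (\<lambda>X. M (L X))"
  using assms by (simp add: linear_map_def)

lemma linear_map_diff:
  assumes L: "linear_map d d' L" and M: "linear_map d d' M"
  shows "linear_map d d' (\<lambda>X. L X - M X)"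
proof -
  note c = linear_mapD(1)[OF L] linear_mapD(1)[OF M]
  have "L (A + B) - M (A + B) = L A - M A + (L B - M B)"
    if "A \<in> carrier_mat d d" "B \<in> carrier_mat d d" for A B
    using that c[OF that(1)] c[OF that(2)] by (intro eq_matI) (auto simp: linear_mapD(2)[OF L] linear_mapD(2)[OF M])
  moreover have "L (a \<cdot>\<^sub>m A) - M (a \<cdot>\<^sub>m A) = a \<cdot>\<^sub>m (L A - M A)" if "A \<in> carrier_mat d d" for A a
    using that c[OF that] by (intro eq_matI) (auto simp: linear_mapD(3)[OF L] linear_mapD(3)[OF M] algebra_simps)
  ultimately show ?thesis using c by (auto simp: linear_map_def intro: minus_carrier_mat)
qed

lemma linear_map_smult:
  assumes L: "linear_map d d' L"
  shows "linear_map d d' (\<lambda>X. c \<cdot>\<^sub>m L X)"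
proof -
  note cr = linear_mapD(1)[OF L]
  have "c \<cdot>\<^sub>m L (A + B) = c \<cdot>\<^sub>m L A + c \<cdot>\<^sub>m L B"
    if "A \<in> carrier_mat d d" "B \<in> carrier_mat d d" for A B
    using that cr[OF that(1)] cr[OF that(2)] by (intro eq_matI) (auto simp: linear_mapD(2)[OF L] algebra_simps)
  moreover have "c \<cdot>\<^sub>m L (a \<cdot>\<^sub>m A) = a \<cdot>\<^sub>m (c \<cdot>\<^sub>m L A)" if "A \<in> carrier_mat d d" for A a
    using that cr[OF that] by (intro eq_matI) (auto simp: linear_mapD(3)[OF L] algebra_simps)
  ultimately show ?thesis using cr by (auto simp: linear_map_def)
qed

lemma linear_map_id [simp]: "linear_map d d id" "linear_map d d (\<lambda>X. X)"
  by (auto simp: linear_map_def)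

lemma tensor_id_diff:
  assumes L: "linear_map d d' L" and M: "linear_map d d' M"
  shows "tensor_map n n d d' id (\<lambda>X. L X - M X) \<rho> =
    tensor_map n n d d' id L \<rho> - tensor_map n n d d' id M \<rho>"
proof (rule eq_mat_pairI)
  fix i j r s assume a: "i < n" "j < n" "r < d'" "s < d'"
  show "tensor_map n n d d' id (\<lambda>X. L X - M X) \<rho> $$ (i * d' + r, j * d' + s) =
    (tensor_map n n d d' id L \<rho> - tensor_map n n d d' id M \<rho>) $$ (i * d' + r, j * d' + s)"
    using a linear_mapD(1)[OF M block_carrier[of d i j \<rho>]] tensor_map_carrier[of n n d d' id M \<rho>]
      pair_index_less[OF a(1,3)] pair_index_less[OF a(2,4)]
    by (simp add: tensor_id_entry[OF linear_map_diff[OF L M]] tensor_id_entry[OF L] tensor_id_entry[OF M])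
qed (auto intro: minus_carrier_mat)

lemma tensor_id_smult:
  assumes L: "linear_map d d' L"
  shows "tensor_map n n d d' id (\<lambda>X. c \<cdot>\<^sub>m L X) \<rho> = c \<cdot>\<^sub>m tensor_map n n d d' id L \<rho>"
proof (rule eq_mat_pairI)
  fix i j r s assume a: "i < n" "j < n" "r < d'" "s < d'"
  show "tensor_map n n d d' id (\<lambda>X. c \<cdot>\<^sub>m L X) \<rho> $$ (i * d' + r, j * d' + s) =
    (c \<cdot>\<^sub>m tensor_map n n d d' id L \<rho>) $$ (i * d' + r, j * d' + s)"
    using a linear_mapD(1)[OF L block_carrier[of d i j \<rho>]] tensor_map_carrier[of n n d d' id L \<rho>]
      pair_index_less[OF a(1,3)] pair_index_less[OF a(2,4)]
    by (simp add: tensor_id_entry[OF linear_map_smult[OF L]] tensor_id_entry[OF L])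
qed auto

lemma tensor_id_comp:
  assumes L: "linear_map d d' L" and M: "linear_map d' d'' M"
  shows "tensor_map n n d d'' id (\<lambda>X. M (L X)) \<rho> =
    tensor_map n n d' d'' id M (tensor_map n n d d' id L \<rho>)"
  by (rule eq_mat_pairI[of _ n d''])
     (auto simp: tensor_id_entry[OF linear_map_comp[OF L M]] tensor_id_entry[OF M] block_tensor_id[OF L])

lemma completely_positive_comp:
  assumes "linear_map d d' L" "completely_positive d d' L"
    and "linear_map d' d'' M" "completely_positive d' d'' M"
  shows "completely_positive d d'' (\<lambda>X. M (L X))"
  using assms(2,4) unfolding completely_positive_def tensor_id_comp[OF assms(1,3)] by blast

lemma channels_comp:
  assumes L: "L \<in> channels d d'" and M: "M \<in> channels d' d''"
  shows "(\<lambda>X. M (L X)) \<in> channels d d''"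
  using assms linear_mapD(1)[of d d' L] completely_positive_comp[of d d' L d'' M] linear_map_comp[of d d' L d'' M]
  by (auto simp: channels_def trace_preserving_def)

text \<open>The trace of the composite is the sum of the traces of its diagonal blocks, and
  \<open>L\<close> preserves each of them.\<close>

lemma tensor_id_trace:
  assumes L: "linear_map d d' L" "trace_preserving d L" and \<rho>: "\<rho> \<in> carrier_mat (n * d) (n * d)"
  shows "mat_trace (tensor_map n n d d' id L \<rho>) = mat_trace \<rho>"
proof -
  have tr: "(\<Sum>r<d'. L (block d i i \<rho>) $$ (r, r)) = (\<Sum>k<d. \<rho> $$ (i * d + k, i * d + k))" for i
  proof -
    have "(\<Sum>r<d'. L (block d i i \<rho>) $$ (r, r)) = mat_trace (L (block d i i \<rho>))"
      using linear_mapD(1)[OF L(1) block_carrier[of d i i \<rho>]] by (simp add: mat_trace_def)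
    also have "\<dots> = mat_trace (block d i i \<rho>)" using L(2) by (simp add: trace_preserving_def)
    finally show ?thesis by (simp add: mat_trace_def block_def)
  qed
  show ?thesis
    unfolding mat_trace_pair[OF tensor_map_carrier] mat_trace_pair[OF \<rho>]
    by (simp add: tensor_id_entry[OF L(1)] tr)
qed

lemma conj_entry:
  fixes K X :: "complex mat"
  assumes K: "K \<in> carrier_mat m n" and X: "X \<in> carrier_mat n n" and rs: "r < m" "s < m"
  shows "(K * X * mat_adjoint K) $$ (r, s) = (\<Sum>k<n. \<Sum>l<n. K $$ (r, k) * X $$ (k, l) * cnj (K $$ (s, l)))"
proof -
  have "(K * X * mat_adjoint K) $$ (r, s) = (\<Sum>l<n. \<Sum>k<n. K $$ (r, k) * X $$ (k, l) * cnj (K $$ (s, l)))"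
    using K X rs by (simp add: scalar_prod_def lessThan_atLeast0 sum_distrib_right)
  then show ?thesis by (subst sum.swap)
qed

lemma form_sum:
  fixes A :: "complex mat"
  assumes "A \<in> carrier_mat n n" "v \<in> carrier_vec n"
  shows "(A *\<^sub>v v) \<bullet>c v = (\<Sum>i<n. \<Sum>j<n. A $$ (i, j) * v $ j * cnj (v $ i))"
  using assms by (simp add: cscalar_prod_sum mult_mat_vec_index sum_distrib_right del: index_mult_mat_vec)

text \<open>The decomposition is required entry by entry, so that no finite sum of matrices has to
  be formed.\<close>

lemma positive_op_sum:
  assumes T: "T \<in> carrier_mat n n" and Q: "\<And>p. p \<in> S \<Longrightarrow> positive_op n (Q p)"
    and eq: "\<And>x y. x < n \<Longrightarrow> y < n \<Longrightarrow> T $$ (x, y) = (\<Sum>p\<in>S. Q p $$ (x, y))"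
  shows "positive_op n T"
proof -
  have "0 \<le> (T *\<^sub>v v) \<bullet>c v" if v: "v \<in> carrier_vec n" for v
  proof -
    have "(T *\<^sub>v v) \<bullet>c v = (\<Sum>x<n. \<Sum>y<n. \<Sum>p\<in>S. Q p $$ (x, y) * v $ y * cnj (v $ x))"
      unfolding form_sum[OF T v] by (simp add: eq sum_distrib_right)
    also have "\<dots> = (\<Sum>x<n. \<Sum>p\<in>S. \<Sum>y<n. Q p $$ (x, y) * v $ y * cnj (v $ x))"
      by (intro sum.cong refl sum.swap)
    also have "\<dots> = (\<Sum>p\<in>S. \<Sum>x<n. \<Sum>y<n. Q p $$ (x, y) * v $ y * cnj (v $ x))"
      by (rule sum.swap)
    also have "\<dots> = (\<Sum>p\<in>S. (Q p *\<^sub>v v) \<bullet>c v)"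
      using Q v by (intro sum.cong refl form_sum[symmetric]) (auto simp: positive_op_def)
    also have "0 \<le> \<dots>" using Q v by (intro sum_nonneg) (auto simp: positive_op_def)
    finally show ?thesis .
  qed
  then show ?thesis using T by (simp add: positive_op_def)
qed

text \<open>The matrix 1 tensor \<open>K\<close> is block diagonal, so conjugation by it conjugates
  every block by \<open>K\<close>. This matches \<open>tensor_id_entry\<close> for a single Kraus
  term.\<close>

lemma tensor_conj_entry:
  assumes K: "K \<in> carrier_mat d' d" and P: "P \<in> carrier_mat (n * d) (n * d)"
    and ij: "i < n" "j < n" and rs: "r < d'" "s < d'"
  shows "(kron (1\<^sub>m n) K * P * mat_adjoint (kron (1\<^sub>m n) K)) $$ (i * d' + r, j * d' + s)
    = (K * block d i j P * mat_adjoint K) $$ (r, s)"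
proof -
  have kr: "kron (1\<^sub>m n) K $$ (a * d' + q, b * d + k) = (if a = b then K $$ (q, k) else 0)"
    if "a < n" "b < n" "q < d'" "k < d" for a b q k
    using that kron_entry[OF one_carrier_mat K] by simp
  note c = kron_carrier[OF one_carrier_mat K, of n]
  have "(kron (1\<^sub>m n) K * P * mat_adjoint (kron (1\<^sub>m n) K)) $$ (i * d' + r, j * d' + s)
      = (\<Sum>i'<n. \<Sum>k<d. \<Sum>j'<n. \<Sum>l<d. if i = i' \<and> j = j' then
          K $$ (r, k) * P $$ (i' * d + k, j' * d + l) * cnj (K $$ (s, l)) else 0)"
    unfolding conj_entry[OF c P pair_index_less[OF ij(1) rs(1)] pair_index_less[OF ij(2) rs(2)]] sum_pair_index
    using ij rs by (intro sum.cong refl) (auto simp: kr)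
  also have "\<dots> = (\<Sum>i'<n. \<Sum>j'<n. \<Sum>k<d. \<Sum>l<d. if i = i' \<and> j = j' then
          K $$ (r, k) * P $$ (i' * d + k, j' * d + l) * cnj (K $$ (s, l)) else 0)"
    by (intro sum.cong refl sum.swap)
  also have "\<dots> = (\<Sum>k<d. \<Sum>l<d. K $$ (r, k) * P $$ (i * d + k, j * d + l) * cnj (K $$ (s, l)))"
    by (rule sum4_delta[OF ij])
  also have "\<dots> = (K * block d i j P * mat_adjoint K) $$ (r, s)"
    unfolding conj_entry[OF K block_carrier rs] by (simp add: block_def)
  finally show ?thesis .
qed

text \<open>Tensoring with the identity turns each Kraus term into a conjugation by 1 tensor
  \<open>K p\<close>, which preserves positivity. Complete positivity of every concrete map below
  comes from this criterion and from composition.\<close>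

lemma kraus_completely_positive:
  assumes lin: "linear_map d d' L" and K: "\<And>p. p \<in> S \<Longrightarrow> K p \<in> carrier_mat d' d"
    and eq: "\<And>X r s. X \<in> carrier_mat d d \<Longrightarrow> r < d' \<Longrightarrow> s < d' \<Longrightarrow>
      L X $$ (r, s) = (\<Sum>p\<in>S. (K p * X * mat_adjoint (K p)) $$ (r, s))"
  shows "completely_positive d d' L"
  unfolding completely_positive_def
proof (intro allI impI)
  fix n P assume P: "positive_op (n * d) P"
  then have Pc: "P \<in> carrier_mat (n * d) (n * d)" by (simp add: positive_op_def)
  define Q where "Q p = kron (1\<^sub>m n) (K p) * P * mat_adjoint (kron (1\<^sub>m n) (K p))" for p
  show "positive_op (n * d') (tensor_map n n d d' id L P)"
  proof (rule positive_op_sum[where S = S and Q = Q])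
    fix p assume "p \<in> S"
    then have "kron (1\<^sub>m n) (K p) \<in> carrier_mat (n * d') (n * d)"
      by (intro kron_carrier K) auto
    then show "positive_op (n * d') (Q p)" unfolding Q_def using P by (rule positive_op_conj)
  next
    fix x y assume "x < n * d'" "y < n * d'"
    then show "tensor_map n n d d' id L P $$ (x, y) = (\<Sum>p\<in>S. Q p $$ (x, y))"
      by (elim pair_indexE)
         (auto simp: tensor_id_entry[OF lin] eq Q_def tensor_conj_entry[OF K Pc] intro!: sum.cong)
  qed simp
qed

section \<open>Partial trace and depolarisation\<close>

definition ptrace :: "nat \<Rightarrow> nat \<Rightarrow> complex mat \<Rightarrow> complex mat" where
  "ptrace m d X = mat d d (\<lambda>(k, l). \<Sum>i<m. X $$ (i * d + k, i * d + l))"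

text \<open>A maximally mixed first factor. After \<open>ptrace\<close> it yields the complete
  depolarisation of \<open>A\<close>; before the unitary it is the first half of Bob's
  channel.\<close>

definition append_mixed :: "nat \<Rightarrow> complex mat \<Rightarrow> complex mat" where
  "append_mixed m X = (1 / of_nat m) \<cdot>\<^sub>m kron (1\<^sub>m m) X"

text \<open>The Kraus matrices used below have at most one nonzero entry in each row, so the double
  sum in \<open>conj_entry\<close> collapses to a single term.\<close>

lemma sum2_delta:
  fixes f :: "'a \<Rightarrow> 'b \<Rightarrow> complex"
  assumes "finite A" "finite B" "a \<in> A" "b \<in> B"
  shows "(\<Sum>k\<in>A. \<Sum>l\<in>B. (if k = a then c else 0) * f k l * cnj (if l = b then c' else 0)) = c * f a b * cnj c'"
proof -
  have "(\<Sum>l\<in>B. (if k = a then c else 0) * f k l * cnj (if l = b then c' else 0))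
      = (if k = a then c * f a b * cnj c' else 0)" for k
  proof -
    have "(\<Sum>l\<in>B. (if k = a then c else 0) * f k l * cnj (if l = b then c' else 0))
        = (\<Sum>l\<in>B. if l = b then (if k = a then c * f a b * cnj c' else 0) else 0)"
      by (rule sum.cong) auto
    then show ?thesis using assms by simp
  qed
  then show ?thesis using assms by simp
qed

lemma ptrace_carrier [simp]: "ptrace m d X \<in> carrier_mat d d"
  by (simp add: ptrace_def)

lemma ptrace_linear: "linear_map (m * d) d (ptrace m d)"
  unfolding linear_map_def
proof (intro conjI ballI allI)
  fix A B :: "complex mat" and c :: complex
  assume A: "A \<in> carrier_mat (m * d) (m * d)"
  show "ptrace m d (c \<cdot>\<^sub>m A) = c \<cdot>\<^sub>m ptrace m d A"
    using A by (intro eq_matI) (auto simp: ptrace_def pair_index_less sum_distrib_left)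
  assume B: "B \<in> carrier_mat (m * d) (m * d)"
  show "ptrace m d (A + B) = ptrace m d A + ptrace m d B"
    using A B by (intro eq_matI) (auto simp: ptrace_def pair_index_less sum.distrib)
qed simp

text \<open>The Kraus operators are <p| tensor 1, one for each basis vector of the discarded
  factor.\<close>

lemma ptrace_completely_positive: "completely_positive (m * d) d (ptrace m d)"
proof (rule kraus_completely_positive[OF ptrace_linear, where S = "{..<m}"
      and K = "\<lambda>p. mat d (m * d) (\<lambda>(r, c). if c = p * d + r then 1 else 0)"])
  fix X :: "complex mat" and r s assume X: "X \<in> carrier_mat (m * d) (m * d)" and rs: "r < d" "s < d"
  have "(mat d (m * d) (\<lambda>(r, c). if c = p * d + r then 1 else 0) * X *
      mat_adjoint (mat d (m * d) (\<lambda>(r, c). if c = p * d + r then 1 else 0))) $$ (r, s)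
      = X $$ (p * d + r, p * d + s)" if p: "p < m" for p
  proof -
    have "(mat d (m * d) (\<lambda>(r, c). if c = p * d + r then 1 else 0) * X *
      mat_adjoint (mat d (m * d) (\<lambda>(r, c). if c = p * d + r then 1 else 0))) $$ (r, s)
      = (\<Sum>k<m * d. \<Sum>l<m * d. (if k = p * d + r then 1 else 0) * X $$ (k, l) *
          cnj (if l = p * d + s then 1 else 0))"
      by (subst conj_entry[OF _ X rs]) (auto simp: rs)
    then show ?thesis using sum2_delta[of "{..<m * d}" "{..<m * d}" "p * d + r" "p * d + s" 1 "\<lambda>k l. X $$ (k, l)" 1]
      pair_index_less[OF p rs(1)] pair_index_less[OF p rs(2)] by simp
  qed
  then show "ptrace m d X $$ (r, s) = (\<Sum>p<m. (mat d (m * d) (\<lambda>(r, c). if c = p * d + r then 1 else 0) * X *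
      mat_adjoint (mat d (m * d) (\<lambda>(r, c). if c = p * d + r then 1 else 0))) $$ (r, s))"
    using rs by (simp add: ptrace_def)
qed auto

lemma ptrace_channel: "ptrace m d \<in> channels (m * d) d"
proof -
  have "mat_trace (ptrace m d A) = mat_trace A" if "A \<in> carrier_mat (m * d) (m * d)" for A
    unfolding mat_trace_pair[OF that] by (simp add: ptrace_def mat_trace_def sum.swap[of _ "{..<m}"])
  then show ?thesis
    by (simp add: channels_def trace_preserving_def ptrace_linear ptrace_completely_positive)
qed

lemma unitary_channel_linear:
  assumes U: "U \<in> carrier_mat m n" shows "linear_map n m (unitary_channel U)"
  unfolding linear_map_def unitary_channel_def
proof (intro conjI ballI allI)
  note a = mat_adjoint_carrier[OF U]
  fix A B :: "complex mat" and c :: complex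
  assume A: "A \<in> carrier_mat n n"
  show "U * A * mat_adjoint U \<in> carrier_mat m m" using U A a by auto
  show "U * (c \<cdot>\<^sub>m A) * mat_adjoint U = c \<cdot>\<^sub>m (U * A * mat_adjoint U)"
    using U A a by (simp add: mult_smult_distrib[OF U A] mult_smult_assoc_mat[OF mult_carrier_mat[OF U A] a])
  assume B: "B \<in> carrier_mat n n"
  show "U * (A + B) * mat_adjoint U = U * A * mat_adjoint U + U * B * mat_adjoint U"
    by (simp add: mult_add_distrib_mat[OF U A B]
        add_mult_distrib_mat[OF mult_carrier_mat[OF U A] mult_carrier_mat[OF U B] a])
qed

lemma unitary_channel_completely_positive:
  assumes U: "U \<in> carrier_mat m n" shows "completely_positive n m (unitary_channel U)"
  using U by (intro kraus_completely_positive[OF unitary_channel_linear[OF U], where S = "{()}" and K = "\<lambda>_. U"])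
    (auto simp: unitary_channel_def)

lemma unitary_channel_channel:
  assumes U: "unitary_op n m U" shows "unitary_channel U \<in> channels n m"
proof -
  have "U \<in> carrier_mat m n" using U by (simp add: unitary_op_def)
  then show ?thesis
    by (simp add: channels_def trace_preserving_def unitary_channel_linear unitary_channel_completely_positive)
       (simp add: unitary_channel_def mat_trace_unitary_conj[OF U])
qed

lemma append_mixed_carrier [simp]:
  "X \<in> carrier_mat d d \<Longrightarrow> append_mixed m X \<in> carrier_mat (m * d) (m * d)"
  by (simp add: append_mixed_def kron_carrier)

lemma append_mixed_entry:
  assumes "X \<in> carrier_mat d d" "i < m" "j < m" "k < d" "l < d"
  shows "append_mixed m X $$ (i * d + k, j * d + l) = (if i = j then X $$ (k, l) / of_nat m else 0)"
  using assms kron_carrier[OF one_carrier_mat[of m] assms(1)] pair_index_less[of i m k d] pair_index_less[of j m l d]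
  by (simp add: append_mixed_def kron_entry[OF one_carrier_mat])

lemma append_mixed_linear: "linear_map d (m * d) (append_mixed m)"
  unfolding linear_map_def
proof (intro conjI ballI allI)
  fix A B :: "complex mat" and c :: complex
  assume A: "A \<in> carrier_mat d d"
  show "append_mixed m (c \<cdot>\<^sub>m A) = c \<cdot>\<^sub>m append_mixed m A"
  proof (rule eq_mat_pairI[of _ m d])
    fix i j k l assume "i < m" "j < m" "k < d" "l < d"
    then show "append_mixed m (c \<cdot>\<^sub>m A) $$ (i * d + k, j * d + l) = (c \<cdot>\<^sub>m append_mixed m A) $$ (i * d + k, j * d + l)"
      using A append_mixed_carrier[OF A, of m, THEN carrier_matD(1)] append_mixed_carrier[OF A, of m, THEN carrier_matD(2)]
      by (simp add: append_mixed_entry pair_index_less)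
  qed (use A in auto)
  assume B: "B \<in> carrier_mat d d"
  show "append_mixed m (A + B) = append_mixed m A + append_mixed m B"
  proof (rule eq_mat_pairI[of _ m d])
    fix i j k l assume "i < m" "j < m" "k < d" "l < d"
    then show "append_mixed m (A + B) $$ (i * d + k, j * d + l) = (append_mixed m A + append_mixed m B) $$ (i * d + k, j * d + l)"
      using A B append_mixed_carrier[OF B, of m, THEN carrier_matD(1)] append_mixed_carrier[OF B, of m, THEN carrier_matD(2)]
      by (simp add: append_mixed_entry pair_index_less add_divide_distrib)
  qed (use A B in auto)
qed simp

lemma inverse_sqrt_square: "complex_of_real (1 / sqrt (real m)) * complex_of_real (1 / sqrt (real m)) = 1 / of_nat m"
proof -
  have "1 / sqrt (real m) * (1 / sqrt (real m)) = 1 / real m" by simp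
  then show ?thesis by (metis of_real_divide of_real_1 of_real_mult of_real_of_nat_eq)
qed

text \<open>The Kraus operators are |p> tensor 1, scaled by 1 / sqrt m because two factors of it
  must give the weight 1 / m of each basis vector.\<close>

lemma append_mixed_completely_positive: "completely_positive d (m * d) (append_mixed m)"
proof (rule kraus_completely_positive[OF append_mixed_linear, where S = "{..<m}"
      and K = "\<lambda>p. mat (m * d) d (\<lambda>(x, c). if x = p * d + c then complex_of_real (1 / sqrt (real m)) else 0)"])
  let ?q = "complex_of_real (1 / sqrt (real m))"
  let ?K = "\<lambda>p. mat (m * d) d (\<lambda>(x, c). if x = p * d + c then ?q else 0)"
  fix X :: "complex mat" and x y assume X: "X \<in> carrier_mat d d" and xy: "x < m * d" "y < m * d"
  obtain i k where x: "i < m" "k < d" "x = i * d + k" using xy(1) by (elim pair_indexE)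
  obtain j l where y: "j < m" "l < d" "y = j * d + l" using xy(2) by (elim pair_indexE)
  have "(?K p * X * mat_adjoint (?K p)) $$ (x, y) = (if p = i \<and> i = j then X $$ (k, l) / of_nat m else 0)"
    if p: "p < m" for p
  proof -
    have "(?K p * X * mat_adjoint (?K p)) $$ (x, y) =
        (\<Sum>k'<d. \<Sum>l'<d. (if k' = k then (if p = i then ?q else 0) else 0) * X $$ (k', l') *
          cnj (if l' = l then (if p = j then ?q else 0) else 0))"
      by (subst conj_entry[OF _ X xy]) (use xy x y in \<open>auto intro!: sum.cong\<close>)
    also have "\<dots> = (if p = i then ?q else 0) * X $$ (k, l) * cnj (if p = j then ?q else 0)"
      using x y by (intro sum2_delta) auto
    also have "\<dots> = (if p = i \<and> i = j then X $$ (k, l) * (?q * ?q) else 0)" by simp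
    finally show ?thesis unfolding inverse_sqrt_square by simp
  qed
  then have "(\<Sum>p<m. (?K p * X * mat_adjoint (?K p)) $$ (x, y))
      = (\<Sum>p<m. if p = i then (if i = j then X $$ (k, l) / of_nat m else 0) else 0)"
    by (intro sum.cong refl) auto
  also have "\<dots> = append_mixed m X $$ (x, y)"
    using x y append_mixed_entry[OF X x(1) y(1) x(2) y(2)] by simp
  finally show "append_mixed m X $$ (x, y) = (\<Sum>p<m. (?K p * X * mat_adjoint (?K p)) $$ (x, y))" ..
qed auto

lemma append_mixed_channel:
  assumes "0 < m" shows "append_mixed m \<in> channels d (m * d)"
proof -
  have "mat_trace (append_mixed m A) = mat_trace A" if A: "A \<in> carrier_mat d d" for A
    using A assms unfolding mat_trace_pair[OF append_mixed_carrier[OF A]]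
    by (simp add: append_mixed_entry mat_trace_def sum_divide_distrib[symmetric])
  then show ?thesis
    by (simp add: channels_def trace_preserving_def append_mixed_linear append_mixed_completely_positive)
qed

text \<open>Counterpart of \<open>tensor_conj_entry\<close> with the identity on the second factor:
  \<open>T\<close> mixes the outer indices while \<open>k\<close> and \<open>l\<close> are carried
  along.\<close>

lemma kron_one_conj_entry:
  assumes T: "T \<in> carrier_mat m m" and X: "X \<in> carrier_mat (m * d) (m * d)"
    and ab: "a < m" "b < m" and kl: "k < d" "l < d"
  shows "(kron T (1\<^sub>m d) * X * mat_adjoint (kron T (1\<^sub>m d))) $$ (a * d + k, b * d + l)
    = (\<Sum>e<m. \<Sum>f<m. T $$ (a, e) * X $$ (e * d + k, f * d + l) * cnj (T $$ (b, f)))"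
proof -
  have "(kron T (1\<^sub>m d) * X * mat_adjoint (kron T (1\<^sub>m d))) $$ (a * d + k, b * d + l)
      = (\<Sum>e<m. \<Sum>k'<d. \<Sum>f<m. \<Sum>l'<d. (if k' = k then T $$ (a, e) else 0) * X $$ (e * d + k', f * d + l') *
          cnj (if l' = l then T $$ (b, f) else 0))"
    unfolding conj_entry[OF kron_carrier[OF T one_carrier_mat] X pair_index_less[OF ab(1) kl(1)] pair_index_less[OF ab(2) kl(2)]]
      sum_pair_index
    using ab kl by (intro sum.cong refl) (auto simp: kron_entry[OF T one_carrier_mat])
  also have "\<dots> = (\<Sum>e<m. \<Sum>f<m. \<Sum>k'<d. \<Sum>l'<d. (if k' = k then T $$ (a, e) else 0) * X $$ (e * d + k', f * d + l') *
          cnj (if l' = l then T $$ (b, f) else 0))"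
    by (intro sum.cong refl sum.swap)
  also have "\<dots> = (\<Sum>e<m. \<Sum>f<m. T $$ (a, e) * X $$ (e * d + k, f * d + l) * cnj (T $$ (b, f)))"
    using kl by (intro sum.cong refl sum2_delta) auto
  finally show ?thesis .
qed

text \<open>
  Replacing \<open>A\<close> by the maximally mixed state is a mixture of Pauli conjugations in which the identity has
  weight \<open>1 / m\<^sup>2\<close>; removing that term leaves a completely positive map. In place of the other Pauli
  operators we use the Kraus operators $|c\rangle\langle e| / \sqrt m$ for \<open>c \<noteq> e\<close> (the case \<open>h = True\<close>) and
  $(|c\rangle\langle c| - |e\rangle\langle e|) / \sqrt{2 m^2}$ (the case \<open>h = False\<close>) of the same map.
\<close>
definition depol_kraus :: "nat \<Rightarrow> bool \<times> nat \<times> nat \<Rightarrow> complex mat" where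
  "depol_kraus m = (\<lambda>(h, c, e). mat m m (\<lambda>(a, f).
     if h then (if f = e then (if a = c \<and> c \<noteq> e then complex_of_real (1 / sqrt (real m)) else 0) else 0)
     else (if f = a then (of_bool (a = c) - of_bool (a = e)) * complex_of_real (1 / sqrt (2 * (real m)\<^sup>2)) else 0)))"

lemma depol_remainder_linear:
  "linear_map (m * d) (m * d) (\<lambda>X. append_mixed m (ptrace m d X) - (1 / (of_nat m)\<^sup>2) \<cdot>\<^sub>m X)"
  by (rule linear_map_diff[OF linear_map_comp[OF ptrace_linear append_mixed_linear] linear_map_smult[OF linear_map_id(2)]])

text \<open>At outer indices \<open>a\<close>, \<open>b\<close> the \<open>True\<close> family
  contributes only for \<open>a = b\<close>, namely all \<open>Z e e / m\<close> with
  \<open>e\<close> different from \<open>a\<close>. The \<open>False\<close> family multiplies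
  \<open>Z a b\<close> by (m [a = b] - 1) / m^2. On the diagonal this is 1/m - 1/m^2, the missing
  term of the partial trace less the multiple of \<open>X\<close> that is removed; off the diagonal
  it is exactly -1/m^2.\<close>

lemma depol_remainder_completely_positive:
  "completely_positive (m * d) (m * d) (\<lambda>X. append_mixed m (ptrace m d X) - (1 / (of_nat m)\<^sup>2) \<cdot>\<^sub>m X)"
proof (rule kraus_completely_positive[OF depol_remainder_linear,
      where S = "UNIV \<times> {..<m} \<times> {..<m}" and K = "\<lambda>p. kron (depol_kraus m p) (1\<^sub>m d)"])
  have Tc: "depol_kraus m p \<in> carrier_mat m m" for p
    by (cases p) (simp add: depol_kraus_def)
  then show "kron (depol_kraus m p) (1\<^sub>m d) \<in> carrier_mat (m * d) (m * d)" for p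
    by (intro kron_carrier) auto
  fix X :: "complex mat" and x y assume X: "X \<in> carrier_mat (m * d) (m * d)" and xy: "x < m * d" "y < m * d"
  then have m: "0 < m" by (auto intro: gr0I)
  obtain a k where x: "a < m" "k < d" "x = a * d + k" using xy(1) by (elim pair_indexE)
  obtain b l where y: "b < m" "l < d" "y = b * d + l" using xy(2) by (elim pair_indexE)
  define Z where "Z e f = X $$ (e * d + k, f * d + l)" for e f
  define q where "q = complex_of_real (1 / sqrt (real m))"
  define q' where "q' = complex_of_real (1 / sqrt (2 * (real m)\<^sup>2))"
  have q: "q * cnj q = 1 / of_nat m" unfolding q_def by (simp only: complex_cnj_complex_of_real inverse_sqrt_square)
  have q': "q' * cnj q' = 1 / (2 * (of_nat m)\<^sup>2)"
  proof -
    have "1 / sqrt (2 * (real m)\<^sup>2) * (1 / sqrt (2 * (real m)\<^sup>2)) = 1 / (2 * (real m)\<^sup>2)" by (simp add: power2_eq_square)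
    then have "complex_of_real (1 / sqrt (2 * (real m)\<^sup>2)) * complex_of_real (1 / sqrt (2 * (real m)\<^sup>2)) = complex_of_real (1 / (2 * (real m)\<^sup>2))"
      by (metis of_real_mult)
    then show ?thesis unfolding q'_def by (simp only: complex_cnj_complex_of_real) simp
  qed
  let ?c = "\<lambda>p. (kron (depol_kraus m p) (1\<^sub>m d) * X * mat_adjoint (kron (depol_kraus m p) (1\<^sub>m d))) $$ (x, y)"
  have t: "?c (True, c, e) = (if c = a then (if a = b \<and> a \<noteq> e then Z e e / of_nat m else 0) else 0)"
    if ce: "c < m" "e < m" for c e
  proof -
    have "?c (True, c, e) = (\<Sum>e'<m. \<Sum>f<m. (if e' = e then (if a = c \<and> c \<noteq> e then q else 0) else 0) * Z e' f
        * cnj (if f = e then (if b = c \<and> c \<noteq> e then q else 0) else 0))"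
      unfolding x(3) y(3) kron_one_conj_entry[OF Tc X x(1) y(1) x(2) y(2)] Z_def q_def using x y
      by (intro sum.cong refl) (simp add: depol_kraus_def)
    also have "\<dots> = (if a = c \<and> c \<noteq> e then q else 0) * Z e e * cnj (if b = c \<and> c \<noteq> e then q else 0)"
      using ce by (intro sum2_delta) auto
    also have "\<dots> = (if c = a then (if a = b \<and> a \<noteq> e then q * cnj q * Z e e else 0) else 0)" by auto
    finally show ?thesis unfolding q by simp
  qed
  have f: "?c (False, c, e) = (of_bool (a = c) - of_bool (a = e)) * (of_bool (b = c) - of_bool (b = e)) * (Z a b / (2 * (of_nat m)\<^sup>2))"
    for c e
  proof -
    have "?c (False, c, e) = (\<Sum>e'<m. \<Sum>f<m. (if e' = a then (of_bool (a = c) - of_bool (a = e)) * q' else 0) * Z e' f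
        * cnj (if f = b then (of_bool (b = c) - of_bool (b = e)) * q' else 0))"
      unfolding x(3) y(3) kron_one_conj_entry[OF Tc X x(1) y(1) x(2) y(2)] Z_def q'_def using x y
      by (intro sum.cong refl) (simp add: depol_kraus_def)
    also have "\<dots> = (of_bool (a = c) - of_bool (a = e)) * q' * Z a b * cnj ((of_bool (b = c) - of_bool (b = e)) * q')"
      using x y by (intro sum2_delta) auto
    also have "\<dots> = (of_bool (a = c) - of_bool (a = e)) * (of_bool (b = c) - of_bool (b = e)) * (Z a b * (q' * cnj q'))"
      by simp
    finally show ?thesis unfolding q' by simp
  qed
  have st: "(\<Sum>c<m. \<Sum>e<m. ?c (True, c, e)) = (if a = b then ((\<Sum>e<m. Z e e) - Z a a) / of_nat m else 0)"
  proof -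
    have "(\<Sum>c<m. \<Sum>e<m. ?c (True, c, e)) = (\<Sum>c<m. if c = a then (\<Sum>e<m. if a = b \<and> a \<noteq> e then Z e e / of_nat m else 0) else 0)"
      by (intro sum.cong refl) (simp add: t)
    also have "\<dots> = (\<Sum>e<m. if a = b \<and> a \<noteq> e then Z e e / of_nat m else 0)" using x by simp
    also have "\<dots> = (if a = b then (\<Sum>e<m. Z e e / of_nat m - (if e = a then Z a a / of_nat m else 0)) else 0)"
      by (auto intro!: sum.cong)
    finally show ?thesis using x by (simp add: sum_subtractf sum_divide_distrib diff_divide_distrib)
  qed
  \<comment> \<open>Summed over all ordered pairs, the sign patterns of |c><c| - |e><e| give twice m
    1 - J, the Laplacian of the complete graph on m vertices, where J is the all-ones matrix. The 2
    arises from meeting each pair in both orders and is cancelled by the 2 in the normalisation of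
    the Kraus operators.\<close>
  have sf: "(\<Sum>c<m. \<Sum>e<m. ?c (False, c, e)) = (of_bool (a = b) * of_nat m - 1) * Z a b / (of_nat m)\<^sup>2"
  proof -
    have "(\<Sum>c<m. \<Sum>e<m. (of_bool (a = c) - of_bool (a = e)) * (of_bool (b = c) - of_bool (b = e)) :: complex)
      = (\<Sum>c<m. \<Sum>e<m. (if a = c then of_bool (a = b) else 0) - (if a = c then (if b = e then 1 else 0) else 0)
          - (if b = c then (if a = e then 1 else 0) else 0) + (if a = e then of_bool (a = b) else 0))"
      by (intro sum.cong refl) auto
    also have "\<dots> = 2 * (of_bool (a = b) * of_nat m - 1)"
    proof -
      have "(\<Sum>e<m. if a = c then (if b = e then 1 else 0) else 0) = (if a = c then 1 else 0 :: complex)"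
        "(\<Sum>e<m. if b = c then (if a = e then 1 else 0) else 0) = (if b = c then 1 else 0 :: complex)" for c
        using x y by auto
      then show ?thesis using x y
        by (simp add: sum.distrib sum_subtractf algebra_simps) (simp flip: sum_distrib_left)
    qed
    finally have "(\<Sum>c<m. \<Sum>e<m. (of_bool (a = c) - of_bool (a = e)) * (of_bool (b = c) - of_bool (b = e)) :: complex)
      = 2 * (of_bool (a = b) * of_nat m - 1)" .
    moreover have "2 * k * (z / (2 * M)) = k * z / M" for k z M :: complex
      by (cases "M = 0") (simp_all add: field_simps)
    ultimately show ?thesis unfolding f sum_distrib_right[symmetric] by (simp only:)
  qed
  have "(\<Sum>p\<in>UNIV \<times> {..<m} \<times> {..<m}. ?c p) = (\<Sum>h\<in>UNIV. \<Sum>c<m. \<Sum>e<m. ?c (h, c, e))"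
    unfolding sum.cartesian_product by (simp add: case_prod_beta)
  also have "\<dots> = (\<Sum>c<m. \<Sum>e<m. ?c (True, c, e)) + (\<Sum>c<m. \<Sum>e<m. ?c (False, c, e))"
    by (simp add: UNIV_bool)
  also have "\<dots> = (if a = b then (\<Sum>e<m. Z e e) / of_nat m else 0) - Z a b / (of_nat m)\<^sup>2"
    unfolding st sf using m by (auto simp: field_simps power2_eq_square)
  also have "\<dots> = (append_mixed m (ptrace m d X) - (1 / (of_nat m)\<^sup>2) \<cdot>\<^sub>m X) $$ (x, y)"
    using xy X append_mixed_entry[OF ptrace_carrier x(1) y(1) x(2) y(2)] x y
    by (simp add: Z_def ptrace_def)
  finally show "(append_mixed m (ptrace m d X) - (1 / (of_nat m)\<^sup>2) \<cdot>\<^sub>m X) $$ (x, y)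
    = (\<Sum>p\<in>UNIV \<times> {..<m} \<times> {..<m}. ?c p)" ..
qed

text \<open>The trace annihilates |i><j| for distinct \<open>i\<close> and \<open>j\<close>, so only
  diagonal blocks survive, and \<open>C\<close> can be applied after summing them. With this both
  maps compared in \<open>signalling\<close> become compositions of channels.\<close>

lemma tensor_trace_map:
  assumes C: "linear_map d d' C"
  shows "tensor_map m 1 d d' trace_map C X = C (ptrace m d X)"
proof (rule eq_matI)
  note Cc = linear_mapD(1)[OF C]
  show "dim_row (tensor_map m 1 d d' trace_map C X) = dim_row (C (ptrace m d X))"
    "dim_col (tensor_map m 1 d d' trace_map C X) = dim_col (C (ptrace m d X))"
    using Cc[OF ptrace_carrier[of m d X]] by auto
  fix r s assume "r < dim_row (C (ptrace m d X))" "s < dim_col (C (ptrace m d X))"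
  then have rs: "r < d'" "s < d'" using Cc[OF ptrace_carrier[of m d X]] by auto
  have kr: "kron (trace_map (mat_unit m i j)) (C (mat_unit d k l)) $$ (r, s)
      = (if j = i then C (mat_unit d k l) $$ (r, s) else 0)" if "i < m" for i j k l
  proof -
    have "trace_map (mat_unit m i j) \<in> carrier_mat 1 1" by (simp add: trace_map_def)
    from kron_entry[OF this Cc[OF mat_unit_carrier[of d k l]], of 0 0 r s]
    have "kron (trace_map (mat_unit m i j)) (C (mat_unit d k l)) $$ (r, s)
        = mat_trace (mat_unit m i j) * C (mat_unit d k l) $$ (r, s)" using rs by (simp add: trace_map_def)
    moreover have "mat_trace (mat_unit m i j) = (\<Sum>a<m. if a = i then (if j = i then 1 else 0) else 0)"
      by (auto simp: mat_trace_def mat_unit_def intro!: sum.cong)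
    ultimately show ?thesis using that by simp
  qed
  have "tensor_map m 1 d d' trace_map C X $$ (r, s) =
      (\<Sum>i<m. \<Sum>j<m. \<Sum>k<d. \<Sum>l<d. X $$ (i * d + k, j * d + l) *
        (if j = i then C (mat_unit d k l) $$ (r, s) else 0))"
    using rs by (simp add: tensor_map_def kr)
  also have "\<dots> = (\<Sum>i<m. \<Sum>j<m. if j = i then (\<Sum>k<d. \<Sum>l<d. X $$ (i * d + k, i * d + l) *
        C (mat_unit d k l) $$ (r, s)) else 0)"
    by (intro sum.cong refl) auto
  also have "\<dots> = (\<Sum>i<m. \<Sum>k<d. \<Sum>l<d. X $$ (i * d + k, i * d + l) * C (mat_unit d k l) $$ (r, s))"
    by (rule sum.cong) simp_all
  also have "\<dots> = (\<Sum>k<d. \<Sum>i<m. \<Sum>l<d. X $$ (i * d + k, i * d + l) * C (mat_unit d k l) $$ (r, s))"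
    by (rule sum.swap)
  also have "\<dots> = (\<Sum>k<d. \<Sum>l<d. \<Sum>i<m. X $$ (i * d + k, i * d + l) * C (mat_unit d k l) $$ (r, s))"
    by (intro sum.cong refl sum.swap)
  also have "\<dots> = C (ptrace m d X) $$ (r, s)"
    unfolding linear_map_entry[OF C ptrace_carrier rs] by (simp add: ptrace_def sum_distrib_right)
  finally show "tensor_map m 1 d d' trace_map C X $$ (r, s) = C (ptrace m d X) $$ (r, s)" .
qed

lemma signalling_ptrace:
  "signalling dA dB dA' dB' \<U> = (INF \<C> \<in> channels dB dB'.
     diamond_norm (dA * dB) dB' (\<lambda>\<rho>. ptrace dA' dB' (\<U> \<rho>) - \<C> (ptrace dA dB \<rho>)))"
  unfolding signalling_def
  by (intro INF_cong refl) (simp add: tensor_trace_map[OF linear_map_id(1)] tensor_trace_map channels_def del: One_nat_def)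

section \<open>Diamond norm and signalling\<close>

lemma channelsD:
  assumes "L \<in> channels d d'"
  shows "linear_map d d' L" "completely_positive d d' L" "trace_preserving d L"
  using assms by (auto simp: channels_def)

lemma channel_states:
  assumes F: "F \<in> channels d d'" and \<rho>: "\<rho> \<in> states (n * d)"
  shows "tensor_map n n d d' id F \<rho> \<in> states (n * d')"
  using channelsD[OF F] \<rho> tensor_id_trace[of d d' F \<rho> n]
  by (auto simp: states_def completely_positive_def positive_op_def)

text \<open>A real supremum is known to dominate its members only when they are bounded above. Here
  2 is a bound, since both channels send states to states.\<close>

lemma diamond_norm_channel_diff:
  assumes F: "F \<in> channels d d'" and G: "G \<in> channels d d'" and \<rho>: "\<rho> \<in> states (d * d)"
  shows "trace_norm (tensor_map d d d d' id F \<rho> - tensor_map d d d d' id G \<rho>)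
    \<le> diamond_norm d d' (\<lambda>X. F X - G X)"
proof -
  let ?D = "\<lambda>\<rho>. tensor_map d d d d' id F \<rho> - tensor_map d d d d' id G \<rho>"
  have D: "tensor_map d d d d' id (\<lambda>X. F X - G X) = ?D"
    using tensor_id_diff[OF channelsD(1)[OF F] channelsD(1)[OF G]] by blast
  have "trace_norm (?D \<sigma>) \<le> 2" if "\<sigma> \<in> states (d * d)" for \<sigma>
    using trace_norm_diff_le[of "d * d'"] channel_states[OF F that] channel_states[OF G that]
    by (fastforce simp: states_def)
  then have "bdd_above ((\<lambda>\<sigma>. trace_norm (?D \<sigma>)) ` states (d * d))" by (intro bdd_aboveI2)
  then show ?thesis unfolding diamond_norm_def D by (rule cSUP_upper[OF \<rho>])
qed

definition pure_op :: "nat \<Rightarrow> (nat \<Rightarrow> complex) \<Rightarrow> complex mat" where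
  "pure_op n f = mat n n (\<lambda>(x, y). f x * cnj (f y))"

text \<open>The form of |f><f| at \<open>v\<close> is |<v|f>|^2.\<close>

lemma pure_op_state:
  assumes "(\<Sum>x<n. f x * cnj (f x)) = 1"
  shows "pure_op n f \<in> states n"
proof -
  have "0 \<le> (pure_op n f *\<^sub>v v) \<bullet>c v" if v: "v \<in> carrier_vec n" for v
  proof -
    define z where "z = (\<Sum>x<n. f x * cnj (v $ x))"
    have "(pure_op n f *\<^sub>v v) \<bullet>c v = (\<Sum>x<n. \<Sum>y<n. f x * cnj (f y) * v $ y * cnj (v $ x))"
      using v by (subst form_sum) (auto simp: pure_op_def)
    also have "\<dots> = z * cnj z"
      unfolding z_def cnj_sum sum_product by (intro sum.cong refl) simp
    also have "0 \<le> \<dots>" by (simp add: less_eq_complex_def complex_mult_cnj)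
    finally show ?thesis .
  qed
  then show ?thesis using assms by (simp add: states_def positive_op_def mat_trace_def) (simp add: pure_op_def)
qed

lemma states_nonempty:
  assumes "0 < n" shows "states n \<noteq> {}"
proof -
  have "pure_op n (\<lambda>x. of_bool (x = 0)) \<in> states n"
    using assms by (intro pure_op_state) (simp add: of_bool_def if_distrib cong: if_cong)
  then show ?thesis by blast
qed

text \<open>One state is enough, because the supremum dominates its nonnegative trace norm. This
  supplies the lower bound that the infimum in \<open>signalling\<close> requires.\<close>

lemma diamond_norm_channel_diff_nonneg:
  assumes "F \<in> channels d d'" "G \<in> channels d d'" "0 < d"
  shows "0 \<le> diamond_norm d d' (\<lambda>X. F X - G X)"
proof -
  obtain \<rho> where \<rho>: "\<rho> \<in> states (d * d)" using states_nonempty[of "d * d"] assms(3) by auto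
  let ?X = "tensor_map d d d d' id F \<rho>" and ?Y = "tensor_map d d d d' id G \<rho>"
  have p: "positive_op (d * d') ?X" "positive_op (d * d') ?Y"
    using channel_states[OF assms(1) \<rho>] channel_states[OF assms(2) \<rho>] by (auto simp: states_def)
  have "0 \<le> trace_norm (?X - ?Y)"
    using p diff_hermitian[OF tensor_map_carrier tensor_map_carrier positive_op_hermitian[OF p(1)] positive_op_hermitian[OF p(2)]]
    by (intro trace_norm_nonneg[of _ "d * d'"]) (auto intro: minus_carrier_mat)
  then show ?thesis using diamond_norm_channel_diff[OF assms(1,2) \<rho>] by linarith
qed

lemma positive_op_smult:
  assumes P: "positive_op n P" and c: "0 \<le> c"
  shows "positive_op n (complex_of_real c \<cdot>\<^sub>m P)"
proof -
  have Pc: "P \<in> carrier_mat n n" using P by (simp add: positive_op_def)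
  have "(complex_of_real c \<cdot>\<^sub>m P *\<^sub>v v) \<bullet>c v = complex_of_real c * ((P *\<^sub>v v) \<bullet>c v)" if "v \<in> carrier_vec n" for v
    using Pc that by (simp add: form_sum[of _ n] sum_distrib_left algebra_simps)
  then show ?thesis using P c by (auto simp: positive_op_def less_eq_complex_def)
qed

text \<open>Comparing \<open>F\<close> and \<open>G\<close> by their traces alone would give only 2.
  Both contain \<open>\<epsilon>\<close> times \<open>F\<close> as a completely positive part, with
  \<open>\<epsilon>\<close> equal to 1 / dA^2; cancelling it first saves \<open>\<epsilon>\<close>
  on each side.\<close>

lemma signalling_le:
  assumes d: "0 < dA" "0 < dB" and U: "unitary_op (dA * dB) (dA' * dB') U"
  shows "signalling dA dB dA' dB' (unitary_channel U) \<le> 2 * (1 - 1 / (real dA)\<^sup>2)"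
proof -
  let ?N = "dA * dB"
  define F where "F X = ptrace dA' dB' (unitary_channel U X)" for X
  define C where "C X = F (append_mixed dA X)" for X
  define M where "M X = append_mixed dA (ptrace dA dB X) - (1 / (of_nat dA)\<^sup>2) \<cdot>\<^sub>m X" for X
  define G where "G X = C (ptrace dA dB X)" for X
  have F: "F \<in> channels ?N dB'"
    using channels_comp[OF unitary_channel_channel[OF U] ptrace_channel] by (simp add: F_def[abs_def])
  have C: "C \<in> channels dB dB'"
    using channels_comp[OF append_mixed_channel[OF d(1)] F] by (simp add: C_def[abs_def])
  have G: "G \<in> channels ?N dB'"
    using channels_comp[OF ptrace_channel C] by (simp add: G_def[abs_def])
  have Ml: "linear_map ?N ?N M" and Mp: "completely_positive ?N ?N M"
    using depol_remainder_linear[of dA dB] depol_remainder_completely_positive[of dA dB] by (simp_all add: M_def[abs_def])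
  have FM: "F (M X) = G X - (1 / (of_nat dA)\<^sup>2) \<cdot>\<^sub>m F X" if X: "X \<in> carrier_mat ?N ?N" for X
  proof -
    let ?a = "append_mixed dA (ptrace dA dB X)"
    note Fl = linear_mapD[OF channelsD(1)[OF F]]
    have a: "?a \<in> carrier_mat ?N ?N" by simp
    have Fc: "F ?a \<in> carrier_mat dB' dB'" "F X \<in> carrier_mat dB' dB'" using Fl(1) a X by auto
    have "M X = ?a + (- (1 / (of_nat dA)\<^sup>2)) \<cdot>\<^sub>m X" using a X by (intro eq_matI) (auto simp: M_def)
    then have "F (M X) = F ?a + (- (1 / (of_nat dA)\<^sup>2)) \<cdot>\<^sub>m F X"
      using Fl(2)[OF a] Fl(3)[OF X] X by simp
    also have "\<dots> = G X - (1 / (of_nat dA)\<^sup>2) \<cdot>\<^sub>m F X"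
      using Fc by (intro eq_matI) (auto simp: G_def C_def)
    finally show ?thesis .
  qed
  define \<epsilon> where "\<epsilon> = 1 / (real dA)\<^sup>2"
  have \<epsilon>: "1 / (of_nat dA)\<^sup>2 = complex_of_real \<epsilon>" "0 \<le> \<epsilon>" "\<epsilon> \<le> 1"
    using d(1) by (auto simp: \<epsilon>_def divide_le_eq)
  have le: "trace_norm (tensor_map ?N ?N ?N dB' id (\<lambda>X. F X - G X) \<rho>) \<le> 2 * (1 - \<epsilon>)"
    if \<rho>: "\<rho> \<in> states (?N * ?N)" for \<rho>
  proof -
    let ?T = "\<lambda>L. tensor_map ?N ?N ?N dB' id L \<rho>"
    let ?n = "?N * dB'"
    have \<rho>p: "positive_op (?N * ?N) \<rho>" using \<rho> by (simp add: states_def)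
    have X: "positive_op ?n (?T F)" "mat_trace (?T F) = 1" and Y: "mat_trace (?T G) = 1"
      using channel_states[OF F \<rho>] channel_states[OF G \<rho>] by (auto simp: states_def)
    define Z where "Z = ?T (\<lambda>X. F (M X))"
    have Zp: "positive_op ?n Z"
      using completely_positive_comp[OF Ml Mp channelsD(1,2)[OF F]] \<rho>p unfolding Z_def completely_positive_def by blast
    then have Zc: "Z \<in> carrier_mat ?n ?n" by (simp add: positive_op_def)
    have Z: "Z = ?T G - complex_of_real \<epsilon> \<cdot>\<^sub>m ?T F"
    proof -
      \<comment> \<open>\<open>FM\<close> holds only for operators of the right dimension. That
        suffices, because \<open>tensor_map\<close> evaluates its argument maps on matrix units
        only.\<close>
      have "Z = ?T (\<lambda>X. G X - complex_of_real \<epsilon> \<cdot>\<^sub>m F X)"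
        unfolding Z_def \<epsilon>(1)[symmetric] by (simp add: tensor_map_def FM)
      then show ?thesis
        unfolding tensor_id_diff[OF channelsD(1)[OF G] linear_map_smult[OF channelsD(1)[OF F]]]
          tensor_id_smult[OF channelsD(1)[OF F]] .
    qed
    \<comment> \<open>The common part has been cancelled: what is subtracted is positive on both
      sides and has trace \<open>1 - \<epsilon>\<close>.\<close>
    have "?T (\<lambda>X. F X - G X) = complex_of_real (1 - \<epsilon>) \<cdot>\<^sub>m ?T F - Z"
      unfolding tensor_id_diff[OF channelsD(1)[OF F] channelsD(1)[OF G]] Z
      by (intro eq_matI) (auto simp: algebra_simps)
    moreover have sm: "mat_trace (complex_of_real c \<cdot>\<^sub>m ?T F) = complex_of_real c" for c
      using X(2) by (simp add: mat_trace_def sum_distrib_left[symmetric])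
    moreover have "mat_trace Z = 1 - complex_of_real \<epsilon>"
      unfolding Z by (subst mat_trace_diff[of _ ?n]) (simp_all add: Y sm)
    ultimately show ?thesis
      using trace_norm_diff_le[OF positive_op_smult[OF X(1), of "1 - \<epsilon>"] Zp] \<epsilon>(3) by (simp del: of_real_diff)
  qed
  have "signalling dA dB dA' dB' (unitary_channel U) \<le> diamond_norm ?N dB' (\<lambda>X. F X - C (ptrace dA dB X))"
    unfolding signalling_ptrace F_def[symmetric]
  proof (rule cINF_lower[OF _ C], rule bdd_belowI2)
    fix C' assume "C' \<in> channels dB dB'"
    then show "0 \<le> diamond_norm ?N dB' (\<lambda>X. F X - C' (ptrace dA dB X))"
      using channels_comp[OF ptrace_channel] d by (intro diamond_norm_channel_diff_nonneg[OF F]) auto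
  qed
  also have "\<dots> \<le> 2 * (1 - \<epsilon>)"
    unfolding diamond_norm_def G_def[symmetric] using le states_nonempty[of "?N * ?N"] d by (intro cSUP_least) auto
  finally show ?thesis by (simp add: \<epsilon>_def)
qed

text \<open>After SWAP Alice's output carries Bob's input, so discarding it amounts to the partial
  trace over the second input factor, which is the matrix on the right.\<close>

lemma ptrace_swap:
  assumes X: "X \<in> carrier_mat (dA * dB) (dA * dB)"
  shows "ptrace dB dA (unitary_channel (swap_op dA dB) X)
    = mat dA dA (\<lambda>(r, s). \<Sum>b<dB. X $$ (r * dB + b, s * dB + b))"
proof (rule eq_matI)
  let ?S = "swap_op dA dB"
  have Sc: "?S \<in> carrier_mat (dB * dA) (dA * dB)" by (simp add: swap_op_def)
  fix r s assume "r < dim_row (mat dA dA (\<lambda>(r, s). \<Sum>b<dB. X $$ (r * dB + b, s * dB + b)))"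
    "s < dim_col (mat dA dA (\<lambda>(r, s). \<Sum>b<dB. X $$ (r * dB + b, s * dB + b)))"
  then have rs: "r < dA" "s < dA" by auto
  have Se: "?S $$ (b * dA + q, u) = (if u = q * dB + b then 1 else 0)" if "b < dB" "q < dA" "u < dA * dB" for b q u
    using that pair_index_less[OF that(1,2)] by (auto simp: swap_op_def elim!: pair_indexE)
  have "(?S * X * mat_adjoint ?S) $$ (b * dA + r, b * dA + s) = X $$ (r * dB + b, s * dB + b)" if b: "b < dB" for b
  proof -
    have "(?S * X * mat_adjoint ?S) $$ (b * dA + r, b * dA + s)
      = (\<Sum>k<dA * dB. \<Sum>l<dA * dB. (if k = r * dB + b then 1 else 0) * X $$ (k, l) * cnj (if l = s * dB + b then 1 else 0))"
      unfolding conj_entry[OF Sc X pair_index_less[OF b rs(1)] pair_index_less[OF b rs(2)]]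
      using b rs by (intro sum.cong refl) (simp add: Se)
    also have "\<dots> = 1 * X $$ (r * dB + b, s * dB + b) * cnj 1"
      using pair_index_less[OF rs(1) b] pair_index_less[OF rs(2) b] by (intro sum2_delta) auto
    finally show ?thesis by simp
  qed
  then show "ptrace dB dA (unitary_channel ?S X) $$ (r, s)
      = mat dA dA (\<lambda>(r, s). \<Sum>b<dB. X $$ (r * dB + b, s * dB + b)) $$ (r, s)"
    using rs by (simp add: ptrace_def unitary_channel_def)
qed (auto simp: ptrace_def)

text \<open>Trace preservation is read off from \<open>ptrace_swap\<close>: the trace of the reduced
  matrix is the double sum of the diagonal entries of \<open>A\<close>.\<close>

lemma ptrace_swap_channel:
  "(\<lambda>X. ptrace dB dA (unitary_channel (swap_op dA dB) X)) \<in> channels (dA * dB) dA"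
proof -
  have Sc: "swap_op dA dB \<in> carrier_mat (dB * dA) (dA * dB)" by (simp add: swap_op_def)
  have "mat_trace (ptrace dB dA (unitary_channel (swap_op dA dB) A)) = mat_trace A"
    if A: "A \<in> carrier_mat (dA * dB) (dA * dB)" for A
    unfolding ptrace_swap[OF A] mat_trace_pair[OF A] by (simp add: mat_trace_def)
  then show ?thesis
    using linear_map_comp[OF unitary_channel_linear[OF Sc] ptrace_linear]
      completely_positive_comp[OF unitary_channel_linear[OF Sc] unitary_channel_completely_positive[OF Sc]
        ptrace_linear ptrace_completely_positive]
    by (simp add: channels_def trace_preserving_def)
qed

text \<open>For a fixed input state the two outputs both have trace 1, so in
  \<open>trace_norm_ge\<close> only twice the difference of their overlaps with the test vector
  remains. These overlaps are 1 and 1 / dA^2. The assumption \<open>ne\<close> keeps the real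
  infimum from ranging over the empty set.\<close>

lemma signalling_swap_ge:
  assumes d: "0 < dA" "0 < dB" and ne: "channels dB dA \<noteq> {}"
  shows "2 * (1 - 1 / (real dA)\<^sup>2) \<le> signalling dA dB dB dA (unitary_channel (swap_op dA dB))"
  unfolding signalling_ptrace
proof (rule cINF_greatest[OF ne])
  let ?N = "dA * dB"
  fix C assume C: "C \<in> channels dB dA"
  note Cl = channelsD(1)[OF C]
  define F where "F X = ptrace dB dA (unitary_channel (swap_op dA dB) X)" for X
  define G where "G X = C (ptrace dA dB X)" for X
  have F: "F \<in> channels ?N dA" using ptrace_swap_channel by (simp add: F_def[abs_def])
  have G: "G \<in> channels ?N dA" using channels_comp[OF ptrace_channel C] by (simp add: G_def[abs_def])
  define q where "q = complex_of_real (1 / sqrt (real dA))"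
  have q: "q * cnj q = 1 / of_nat dA" unfolding q_def by (simp only: complex_cnj_complex_of_real inverse_sqrt_square)
  have qr: "cnj q = q" by (simp add: q_def)
  \<comment> \<open>The reference is a full copy of the composite input. The entanglement is only
    with \<open>A\<close>: the vector is the sum of |a,0> tensor |a,0> over \<open>a\<close>,
    divided by sqrt dA, and \<open>mod dB = 0\<close> expresses that Bob's input is |0>.\<close>
  define \<psi> where "\<psi> x = (if x div ?N = x mod ?N \<and> x div ?N mod dB = 0 then q else 0)" for x
  define \<rho> where "\<rho> = pure_op (?N * ?N) \<psi>"
  have \<psi>: "\<psi> (i * ?N + k) = (if k = i \<and> i mod dB = 0 then q else 0)" if "k < ?N" for i k
    using that by (auto simp: \<psi>_def)
  have \<rho>: "\<rho> \<in> states (?N * ?N)"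
    unfolding \<rho>_def
  proof (rule pure_op_state)
    have "(\<Sum>x<?N * ?N. \<psi> x * cnj (\<psi> x)) = (\<Sum>i<?N. \<Sum>k<?N. if k = i then (if i mod dB = 0 then q * cnj q else 0) else 0)"
      unfolding sum_pair_index[of _ ?N ?N] by (intro sum.cong refl) (simp add: \<psi>)
    also have "\<dots> = (\<Sum>i<?N. if i mod dB = 0 then q * cnj q else 0)" by (intro sum.cong refl) simp
    also have "\<dots> = (\<Sum>a<dA. \<Sum>b<dB. if b = 0 then q * cnj q else 0)"
      unfolding sum_pair_index by (intro sum.cong refl) simp
    finally show "(\<Sum>x<?N * ?N. \<psi> x * cnj (\<psi> x)) = 1" using d by (simp add: q)
  qed
  have blk: "block ?N (a * dB) (b * dB) \<rho> = (1 / of_nat dA) \<cdot>\<^sub>m mat_unit ?N (a * dB) (b * dB)"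
    if "a < dA" "b < dA" for a b
  proof (rule eq_matI)
    fix k l assume "k < dim_row ((1 / of_nat dA) \<cdot>\<^sub>m mat_unit ?N (a * dB) (b * dB))"
      "l < dim_col ((1 / of_nat dA) \<cdot>\<^sub>m mat_unit ?N (a * dB) (b * dB))"
    then have kl: "k < ?N" "l < ?N" by (auto simp: mat_unit_def)
    have ab: "a * dB < ?N" "b * dB < ?N" using that d by auto
    show "block ?N (a * dB) (b * dB) \<rho> $$ (k, l) = ((1 / of_nat dA) \<cdot>\<^sub>m mat_unit ?N (a * dB) (b * dB)) $$ (k, l)"
      using kl pair_index_less[OF ab(1) kl(1)] pair_index_less[OF ab(2) kl(2)]
      by (simp add: block_def \<rho>_def pure_op_def \<psi> mat_unit_def) (simp add: q)
  qed (auto simp: block_def mat_unit_def)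
  \<comment> \<open>The vector that SWAP followed by discarding Alice's output produces from
    \<open>\<psi>\<close>: Bob holds |r> while the reference holds |r,0>, whose index is
    \<open>r * dB\<close>.\<close>
  define v where "v = vec (?N * dA) (\<lambda>x. if x div dA = x mod dA * dB then q else 0)"
  have vc: "v \<in> carrier_vec (?N * dA)" by (simp add: v_def)
  have ve: "v $ (e * dA + r) = (if e = r * dB then q else 0)" if "e < ?N" "r < dA" for e r
    using that pair_index_less[of e ?N r dA] by (simp add: v_def)
  have rN: "r * dB < ?N" if "r < dA" for r using that d by simp
  have vform: "(\<Sum>x<?N * dA. h x * v $ x) = (\<Sum>r<dA. h (r * dB * dA + r) * q)" for h
  proof -
    have "(\<Sum>x<?N * dA. h x * v $ x) = (\<Sum>e<?N. \<Sum>r<dA. if e = r * dB then h (e * dA + r) * q else 0)"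
      unfolding sum_pair_index[of _ ?N dA] by (intro sum.cong refl) (simp add: ve)
    also have "\<dots> = (\<Sum>r<dA. \<Sum>e<?N. if e = r * dB then h (e * dA + r) * q else 0)" by (rule sum.swap)
    also have "\<dots> = (\<Sum>r<dA. h (r * dB * dA + r) * q)" by (intro sum.cong refl) (simp add: d)
    finally show ?thesis .
  qed
  have vreal: "cnj (v $ x) = v $ x" if "x < ?N * dA" for x using that by (simp add: v_def qr)
  have v1: "v \<bullet>c v = 1"
  proof -
    have "v \<bullet>c v = (\<Sum>x<?N * dA. v $ x * v $ x)" unfolding cscalar_prod_sum[OF vc] by (simp add: vreal)
    also have "\<dots> = (\<Sum>r<dA. v $ (r * dB * dA + r) * q)" by (rule vform)
    also have "\<dots> = (\<Sum>r<dA. q * cnj q)" using rN by (intro sum.cong refl) (simp add: ve qr)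
    finally show ?thesis using d by (simp add: q)
  qed
  let ?T = "\<lambda>L. tensor_map ?N ?N ?N dA id L \<rho>"
  \<comment> \<open>One factor 1 / dA comes from the blocks of \<open>\<rho>\<close>, the other from
    the two amplitudes \<open>q\<close> of \<open>v\<close>. Each term is <r| L(|r,0><s,0|) |s>. For
    \<open>F\<close> all dA^2 of them equal 1, since SWAP hands |r><s| to Bob.\<close>
  have form: "(?T L *\<^sub>v v) \<bullet>c v = (\<Sum>r<dA. \<Sum>s<dA. L (mat_unit ?N (r * dB) (s * dB)) $$ (r, s)) / (of_nat dA)\<^sup>2"
    if L: "linear_map ?N dA L" for L
  proof -
    have "(?T L *\<^sub>v v) \<bullet>c v = (\<Sum>x<?N * dA. (\<Sum>y<?N * dA. ?T L $$ (x, y) * v $ y) * v $ x)"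
      unfolding form_sum[OF tensor_map_carrier vc] by (simp add: sum_distrib_right vreal)
    also have "\<dots> = (\<Sum>r<dA. \<Sum>s<dA. ?T L $$ (r * dB * dA + r, s * dB * dA + s) * q * q)"
      unfolding vform by (simp add: sum_distrib_right)
    also have "\<dots> = (\<Sum>r<dA. \<Sum>s<dA. L (mat_unit ?N (r * dB) (s * dB)) $$ (r, s) / (of_nat dA)\<^sup>2)"
    proof (intro sum.cong refl)
      fix r s assume "r \<in> {..<dA}" "s \<in> {..<dA}"
      then have rs: "r < dA" "s < dA" by auto
      have "?T L $$ (r * dB * dA + r, s * dB * dA + s) = L (mat_unit ?N (r * dB) (s * dB)) $$ (r, s) / of_nat dA"
        unfolding tensor_id_entry[OF L rN[OF rs(1)] rN[OF rs(2)] rs] blk[OF rs] linear_mapD(3)[OF L mat_unit_carrier]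
        using rs linear_mapD(1)[OF L mat_unit_carrier[of ?N "r * dB" "s * dB"]] by simp
      moreover have "q * q = 1 / of_nat dA" using q qr by simp
      ultimately show "?T L $$ (r * dB * dA + r, s * dB * dA + s) * q * q
          = L (mat_unit ?N (r * dB) (s * dB)) $$ (r, s) / (of_nat dA)\<^sup>2"
        by (simp add: power2_eq_square mult.assoc)
    qed
    finally show ?thesis by (simp add: sum_divide_distrib)
  qed
  have "F (mat_unit ?N (r * dB) (s * dB)) $$ (r, s) = 1" if rs: "r < dA" "s < dA" for r s
  proof -
    have "F (mat_unit ?N (r * dB) (s * dB)) $$ (r, s) = (\<Sum>b<dB. if b = 0 then 1 else 0)"
      unfolding F_def ptrace_swap[OF mat_unit_carrier] using rs
      by (auto simp: mat_unit_def pair_index_less intro!: sum.cong)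
    then show ?thesis using d by simp
  qed
  then have fF: "(?T F *\<^sub>v v) \<bullet>c v = 1"
    unfolding form[OF channelsD(1)[OF F]] using d by (simp add: power2_eq_square)
  \<comment> \<open>Tracing \<open>A\<close> out of |r,0><s,0| leaves |0><0| if \<open>r = s\<close>
    and zero otherwise. The surviving diagonal terms add up to the trace of C(|0><0|), which is 1
    for every channel.\<close>
  have "G (mat_unit ?N (r * dB) (s * dB)) $$ (r, s) = (if s = r then C (mat_unit dB 0 0) $$ (r, r) else 0)"
    if rs: "r < dA" "s < dA" for r s
  proof -
    have "ptrace dA dB (mat_unit ?N (r * dB) (s * dB)) = (if s = r then 1 else 0) \<cdot>\<^sub>m mat_unit dB 0 0"
    proof (rule eq_matI)
      fix k l assume "k < dim_row ((if s = r then 1 else 0 :: complex) \<cdot>\<^sub>m mat_unit dB 0 0)"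
        "l < dim_col ((if s = r then 1 else 0 :: complex) \<cdot>\<^sub>m mat_unit dB 0 0)"
      then have kl: "k < dB" "l < dB" by (auto simp: mat_unit_def)
      have "ptrace dA dB (mat_unit ?N (r * dB) (s * dB)) $$ (k, l)
          = (\<Sum>a<dA. if a = r then (if k = 0 \<and> l = 0 \<and> s = r then 1 else 0) else 0)"
        using kl pair_index_eq[OF _ d(2), of k _ r] pair_index_eq[OF _ d(2), of l _ s]
        by (auto simp: ptrace_def mat_unit_def pair_index_less intro!: sum.cong)
      then show "ptrace dA dB (mat_unit ?N (r * dB) (s * dB)) $$ (k, l) = ((if s = r then 1 else 0) \<cdot>\<^sub>m mat_unit dB 0 0) $$ (k, l)"
        using kl rs by (simp add: mat_unit_def)
    qed (auto simp: ptrace_def mat_unit_def)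
    then show ?thesis
      unfolding G_def using linear_mapD(1)[OF Cl mat_unit_carrier[of dB 0 0]] rs
      by (simp add: linear_mapD(3)[OF Cl mat_unit_carrier])
  qed
  then have "(?T G *\<^sub>v v) \<bullet>c v = (\<Sum>r<dA. C (mat_unit dB 0 0) $$ (r, r)) / (of_nat dA)\<^sup>2"
    unfolding form[OF channelsD(1)[OF G]] by simp
  also have "(\<Sum>r<dA. C (mat_unit dB 0 0) $$ (r, r)) = mat_trace (C (mat_unit dB 0 0))"
    using linear_mapD(1)[OF Cl mat_unit_carrier[of dB 0 0]] by (simp add: mat_trace_def)
  also have "\<dots> = mat_trace (mat_unit dB 0 0)"
    using channelsD(3)[OF C] by (simp add: trace_preserving_def)
  also have "\<dots> = 1" using d by (simp add: mat_trace_def mat_unit_def)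
  finally have fG: "(?T G *\<^sub>v v) \<bullet>c v = 1 / (of_nat dA)\<^sup>2" .
  have pos: "positive_op (?N * dA) (?T F)" "positive_op (?N * dA) (?T G)"
    and tr: "mat_trace (?T F) = 1" "mat_trace (?T G) = 1"
    using channel_states[OF F \<rho>] channel_states[OF G \<rho>] by (auto simp: states_def)
  have "((?T F - ?T G) *\<^sub>v v) \<bullet>c v = (?T F *\<^sub>v v) \<bullet>c v - (?T G *\<^sub>v v) \<bullet>c v"
    unfolding form_sum[OF minus_carrier_mat[OF tensor_map_carrier] vc] form_sum[OF tensor_map_carrier vc]
    by (simp add: left_diff_distrib sum_subtractf)
  also have "\<dots> = complex_of_real (1 - 1 / (real dA)\<^sup>2)" unfolding fF fG by simp
  finally have "2 * (1 - 1 / (real dA)\<^sup>2) - Re (mat_trace (?T F - ?T G)) \<le> trace_norm (?T F - ?T G)"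
    using trace_norm_ge[OF minus_carrier_mat[OF tensor_map_carrier]
        diff_hermitian[OF tensor_map_carrier tensor_map_carrier positive_op_hermitian[OF pos(1)] positive_op_hermitian[OF pos(2)]] vc v1]
    by simp
  moreover have "mat_trace (?T F - ?T G) = 0"
    using mat_trace_diff[OF tensor_map_carrier tensor_map_carrier] tr by simp
  ultimately have "2 * (1 - 1 / (real dA)\<^sup>2) \<le> trace_norm (?T F - ?T G)" by simp
  also have "\<dots> \<le> diamond_norm ?N dA (\<lambda>X. F X - G X)"
    by (rule diamond_norm_channel_diff[OF F G \<rho>])
  finally show "2 * (1 - 1 / (real dA)\<^sup>2)
    \<le> diamond_norm ?N dA (\<lambda>\<rho>. ptrace dB dA (unitary_channel (swap_op dA dB) \<rho>) - C (ptrace dA dB \<rho>))"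
    by (simp add: F_def G_def)
qed

theorem lemma3p2:
  fixes dA dB dA' dB' :: nat and U :: "complex mat"
  assumes "0 < dA" and "0 < dB"
    and "unitary_op (dA * dB) (dA' * dB') U"
    and "dA' = dB" and "dB' = dA"
  shows "signalling dA dB dA' dB' (unitary_channel U)
       \<le> signalling dA dB dB dA (unitary_channel (swap_op dA dB))"
proof -
  \<comment> \<open>A witness that Bob has some channel at all, as the infimum for SWAP requires:
    this one discards its input and outputs the maximally mixed state.\<close>
  have "(\<lambda>X. ptrace dB dA (unitary_channel (swap_op dA dB) (append_mixed dA X))) \<in> channels dB dA"
    using channels_comp[OF append_mixed_channel[OF assms(1)] ptrace_swap_channel] .
  then have "channels dB dA \<noteq> {}" by blast
  then show ?thesis
    using signalling_le[OF assms(1-3)] signalling_swap_ge[OF assms(1,2)] by linarith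
qed

end
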